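(* Let $S$ be a multiplicative subset of the commutative ring $R$ and let $\mathscr{F}$ be the set of ideals of $R$ which meet $S$. Then for each $R$-module $M$ there is a unique $R$-linear map $\phi:S^{-1}M\rightarrow M_{\mathscr{F}}$ such that $j_M=\phi\circ\pi$, where $\pi:M\rightarrow S^{-1}M$ is the canonical map. Moreover $\phi$ is bijective. In particular, the $R$-algebras $S^{-1}R$ and $R_{\mathscr{F}}$ are canonically isomorphic.
   Context: All rings are commutative. The family $\mathscr{F}$ of ideals meeting $S$ is non-empty, closed under passing to larger ideals and under finite intersections, and satisfies: if $I\in\mathscr{F}$ and $J$ is an ideal with $(J:a)\in\mathscr{F}$ for all $a\in I$ then $J\in\mathscr{F}$ (i.e. it is an idempotent topologizing system), so the following constructions make sense. For an $R$-module $M$, $\mathscr{F}(M)=\{m\in M:\operatorname{Ann}_R(m)\in\mathscr{F}\}$ (a submodule), and $M_{\mathscr{F}}=\operatorname{colim}_{I\in\mathscr{F}}\operatorname{Hom}_R(I,M/\mathscr{F}(M))$, where $\mathscr{F}$ is directed by reverse inclusion and the transition maps are restrictions; $[f]$ denotes the class of $f:I\to M/\mathscr{F}(M)$. The canonical map $j_M:M\to M_{\mathscr{F}}$ sends $m$ to the class of $R\to M/\mathscr{F}(M)$, $r\mapsto rm+\mathscr{F}(M)$. $R_{\mathscr{F}}$ is a commutative ring: for $f:I\to R/\mathscr{F}(R)$ and $g:J\to R/\mathscr{F}(R)$ $R$-linear with $I,J\in\mathscr{F}$, put $\overline{J}=(J+\mathscr{F}(R))/\mathscr{F}(R)$ and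 $\overline{g}:\overline{J}\to R/\mathscr{F}(R)$, $b+\mathscr{F}(R)\mapsto g(b)$ for $b\in J$; then $f^{-1}(\overline{J})\in\mathscr{F}$ and $[f].[g]=[\overline{g}\circ f|_{f^{-1}(\overline{J})}]$. The unit is the class of the canonical map $R\to R/\mathscr{F}(R)$, and $R_{\mathscr{F}}$ is an $R$-algebra via the ring homomorphism $j_R:R\to R_{\mathscr{F}}$. *)

theory Defs
  imports "HOL-Algebra.Module" "HOL-Algebra.QuotRing"
begin

section \<open>Modules over a commutative ring\<close>

text \<open>
  Only the additive structure and the scalar multiplication of a \<open>module\<close> record are
  relevant for the locale \<open>module\<close>; where a record is used as a module only, its fields
  \<open>mult\<close> and \<open>one\<close> are left \<open>undefined\<close>.
\<close>

definition regular_module :: "('a, 'r) ring_scheme \<Rightarrow> ('a, 'a) module"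
  where "regular_module R =
    \<lparr>carrier = carrier R, mult = mult R, one = one R, zero = zero R, add = add R,
     smult = mult R\<rparr>"

definition linear_maps ::
    "('a, 'r) ring_scheme \<Rightarrow> ('a, 'b, 'm) module_scheme \<Rightarrow> ('a, 'c, 'n) module_scheme
      \<Rightarrow> ('b \<Rightarrow> 'c) set"
  where "linear_maps R M N =
    {f \<in> carrier M \<rightarrow> carrier N.
      (\<forall>x\<in>carrier M. \<forall>y\<in>carrier M. f (x \<oplus>\<^bsub>M\<^esub> y) = f x \<oplus>\<^bsub>N\<^esub> f y) \<and>
      (\<forall>r\<in>carrier R. \<forall>x\<in>carrier M. f (r \<odot>\<^bsub>M\<^esub> x) = r \<odot>\<^bsub>N\<^esub> f x)}"

text \<open>
  The next two predicates also assert that the source and the target are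
  \<open>R\<close>-modules and \<open>R\<close>-algebras, respectively.
\<close>

definition linear_map ::
    "('a, 'r) ring_scheme \<Rightarrow> ('a, 'b, 'm) module_scheme \<Rightarrow> ('a, 'c, 'n) module_scheme
      \<Rightarrow> ('b \<Rightarrow> 'c) \<Rightarrow> bool"
  where "linear_map R M N f \<longleftrightarrow> module R M \<and> module R N \<and> f \<in> linear_maps R M N"

definition algebra_iso ::
    "('a, 'r) ring_scheme \<Rightarrow> ('a, 'b, 'm) module_scheme \<Rightarrow> ('a, 'c, 'n) module_scheme
      \<Rightarrow> ('b \<Rightarrow> 'c) \<Rightarrow> bool"
  where "algebra_iso R A B f \<longleftrightarrow>
    algebra R A \<and> algebra R B \<and> f \<in> ring_iso A B \<and> f \<in> linear_maps R A B"

definition quotient_module ::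
    "('a, 'b, 'm) module_scheme \<Rightarrow> 'b set \<Rightarrow> ('a, 'b set) module"
  where "quotient_module M N =
    \<lparr>carrier = a_rcosets\<^bsub>M\<^esub> N, mult = undefined, one = undefined, zero = N,
     add = (\<lambda>X Y. X <+>\<^bsub>M\<^esub> Y),
     smult = (\<lambda>r X. \<Union>x\<in>X. N +>\<^bsub>M\<^esub> (r \<odot>\<^bsub>M\<^esub> x))\<rparr>"

definition annihilator ::
    "('a, 'r) ring_scheme \<Rightarrow> ('a, 'b, 'm) module_scheme \<Rightarrow> 'b \<Rightarrow> 'a set"
  where "annihilator R M m = {r \<in> carrier R. r \<odot>\<^bsub>M\<^esub> m = \<zero>\<^bsub>M\<^esub>}"


section \<open>Modules and rings of fractions\<close>

text \<open>
  The factor \<open>u\<close> makes this an equivalence relation also when elements of \<open>S\<close> act as zero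
  divisors. In the records below, the unions over representatives pick the
  common class, as in \<open>UN_equiv_class2\<close>.
\<close>

definition fraction_rel ::
    "'a set \<Rightarrow> ('a, 'b, 'm) module_scheme \<Rightarrow> (('b \<times> 'a) \<times> ('b \<times> 'a)) set"
  where "fraction_rel S M =
    {((m, s), (n, t)). m \<in> carrier M \<and> n \<in> carrier M \<and> s \<in> S \<and> t \<in> S \<and>
      (\<exists>u\<in>S. u \<odot>\<^bsub>M\<^esub> (t \<odot>\<^bsub>M\<^esub> m) = u \<odot>\<^bsub>M\<^esub> (s \<odot>\<^bsub>M\<^esub> n))}"

definition fraction ::
    "'a set \<Rightarrow> ('a, 'b, 'm) module_scheme \<Rightarrow> 'b \<Rightarrow> 'a \<Rightarrow> ('b \<times> 'a) set"
  where "fraction S M m s = fraction_rel S M `` {(m, s)}"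

definition fraction_module ::
    "('a, 'r) ring_scheme \<Rightarrow> 'a set \<Rightarrow> ('a, 'b, 'm) module_scheme
      \<Rightarrow> ('a, ('b \<times> 'a) set) module"
  where "fraction_module R S M =
    \<lparr>carrier = (carrier M \<times> S) // fraction_rel S M,
     mult = undefined, one = undefined,
     zero = fraction S M \<zero>\<^bsub>M\<^esub> \<one>\<^bsub>R\<^esub>,
     add = (\<lambda>X Y. \<Union>(m, s)\<in>X. \<Union>(n, t)\<in>Y.
       fraction S M ((t \<odot>\<^bsub>M\<^esub> m) \<oplus>\<^bsub>M\<^esub> (s \<odot>\<^bsub>M\<^esub> n)) (s \<otimes>\<^bsub>R\<^esub> t)),
     smult = (\<lambda>r X. \<Union>(m, s)\<in>X. fraction S M (r \<odot>\<^bsub>M\<^esub> m) s)\<rparr>"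

definition fraction_map ::
    "('a, 'r) ring_scheme \<Rightarrow> 'a set \<Rightarrow> ('a, 'b, 'm) module_scheme \<Rightarrow> 'b \<Rightarrow> ('b \<times> 'a) set"
  where "fraction_map R S M m = fraction S M m \<one>\<^bsub>R\<^esub>"

definition fraction_algebra ::
    "('a, 'r) ring_scheme \<Rightarrow> 'a set \<Rightarrow> ('a, ('a \<times> 'a) set) module"
  where "fraction_algebra R S = (fraction_module R S (regular_module R))
    \<lparr>mult := (\<lambda>X Y. \<Union>(a, s)\<in>X. \<Union>(b, t)\<in>Y.
       fraction S (regular_module R) (a \<otimes>\<^bsub>R\<^esub> b) (s \<otimes>\<^bsub>R\<^esub> t)),
     one := fraction S (regular_module R) \<one>\<^bsub>R\<^esub> \<one>\<^bsub>R\<^esub>\<rparr>"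


section \<open>Localization at a family of ideals\<close>

text \<open>
  The constructions of this section are meaningful for an idempotent
  topologizing system \<open>F\<close>, such as \<open>ideals_meeting R S\<close>.
\<close>

definition ideals_meeting :: "('a, 'r) ring_scheme \<Rightarrow> 'a set \<Rightarrow> 'a set set"
  where "ideals_meeting R S = {I. ideal I R \<and> I \<inter> S \<noteq> {}}"

definition torsion ::
    "('a, 'r) ring_scheme \<Rightarrow> 'a set set \<Rightarrow> ('a, 'b, 'm) module_scheme \<Rightarrow> 'b set"
  where "torsion R F M = {m \<in> carrier M. annihilator R M m \<in> F}"

definition torsion_quotient ::
    "('a, 'r) ring_scheme \<Rightarrow> 'a set set \<Rightarrow> ('a, 'b, 'm) module_scheme \<Rightarrow> ('a, 'b set) module"
  where "torsion_quotient R F M = quotient_module M (torsion R F M)"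

text \<open>
  The directed colimit of the modules of linear maps from \<open>I\<close> to
  \<open>torsion_quotient R F M\<close> is the disjoint union of these modules, modulo agreement on
  a smaller member of \<open>F\<close>. Linear maps on \<open>I\<close> are normalized to be \<open>undefined\<close> outside \<open>I\<close>.
\<close>

definition local_maps ::
    "('a, 'r) ring_scheme \<Rightarrow> 'a set set \<Rightarrow> ('a, 'b, 'm) module_scheme
      \<Rightarrow> ('a set \<times> ('a \<Rightarrow> 'b set)) set"
  where "local_maps R F M =
    (SIGMA I : F.
      linear_maps R ((regular_module R)\<lparr>carrier := I\<rparr>) (torsion_quotient R F M)
        \<inter> extensional I)"

definition germ_rel ::
    "('a, 'r) ring_scheme \<Rightarrow> 'a set set \<Rightarrow> ('a, 'b, 'm) module_scheme
      \<Rightarrow> (('a set \<times> ('a \<Rightarrow> 'b set)) \<times> ('a set \<times> ('a \<Rightarrow> 'b set))) set"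
  where "germ_rel R F M =
    {((I, f), (J, g)). (I, f) \<in> local_maps R F M \<and> (J, g) \<in> local_maps R F M \<and>
      (\<exists>K\<in>F. K \<subseteq> I \<inter> J \<and> (\<forall>a\<in>K. f a = g a))}"

definition germ ::
    "('a, 'r) ring_scheme \<Rightarrow> 'a set set \<Rightarrow> ('a, 'b, 'm) module_scheme
      \<Rightarrow> 'a set \<Rightarrow> ('a \<Rightarrow> 'b set) \<Rightarrow> ('a set \<times> ('a \<Rightarrow> 'b set)) set"
  where "germ R F M I f = germ_rel R F M `` {(I, restrict f I)}"

definition localization_module ::
    "('a, 'r) ring_scheme \<Rightarrow> 'a set set \<Rightarrow> ('a, 'b, 'm) module_scheme
      \<Rightarrow> ('a, ('a set \<times> ('a \<Rightarrow> 'b set)) set) module"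
  where "localization_module R F M =
    \<lparr>carrier = local_maps R F M // germ_rel R F M,
     mult = undefined, one = undefined,
     zero = germ R F M (carrier R) (\<lambda>a. \<zero>\<^bsub>torsion_quotient R F M\<^esub>),
     add = (\<lambda>X Y. \<Union>(I, f)\<in>X. \<Union>(J, g)\<in>Y.
       germ R F M (I \<inter> J) (\<lambda>a. f a \<oplus>\<^bsub>torsion_quotient R F M\<^esub> g a)),
     smult = (\<lambda>r X. \<Union>(I, f)\<in>X.
       germ R F M I (\<lambda>a. r \<odot>\<^bsub>torsion_quotient R F M\<^esub> f a))\<rparr>"

definition localization_map ::
    "('a, 'r) ring_scheme \<Rightarrow> 'a set set \<Rightarrow> ('a, 'b, 'm) module_scheme
      \<Rightarrow> 'b \<Rightarrow> ('a set \<times> ('a \<Rightarrow> 'b set)) set"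
  where "localization_map R F M m =
    germ R F M (carrier R) (\<lambda>r. torsion R F M +>\<^bsub>M\<^esub> (r \<odot>\<^bsub>M\<^esub> m))"

definition image_ideal :: "('a, 'r) ring_scheme \<Rightarrow> 'a set set \<Rightarrow> 'a set \<Rightarrow> 'a set set"
  where "image_ideal R F J = (\<lambda>b. torsion R F (regular_module R) +>\<^bsub>R\<^esub> b) ` J"

definition induced_map ::
    "('a, 'r) ring_scheme \<Rightarrow> 'a set set \<Rightarrow> 'a set \<Rightarrow> ('a \<Rightarrow> 'a set) \<Rightarrow> 'a set \<Rightarrow> 'a set"
  where "induced_map R F J g X =
    (THE y. \<exists>b\<in>J. X = torsion R F (regular_module R) +>\<^bsub>R\<^esub> b \<and> y = g b)"

text \<open>
  The scalar multiplication is the one of \<open>localization_module\<close>; it is also the one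
  induced by the ring homomorphism \<open>localization_map R F (regular_module R)\<close>.
\<close>

definition localization_algebra ::
    "('a, 'r) ring_scheme \<Rightarrow> 'a set set \<Rightarrow> ('a, ('a set \<times> ('a \<Rightarrow> 'a set)) set) module"
  where "localization_algebra R F = (localization_module R F (regular_module R))
    \<lparr>mult := (\<lambda>X Y. \<Union>(I, f)\<in>X. \<Union>(J, g)\<in>Y.
       germ R F (regular_module R) {a \<in> I. f a \<in> image_ideal R F J}
         (\<lambda>a. induced_map R F J g (f a))),
     one := germ R F (regular_module R) (carrier R)
       (\<lambda>r. torsion R F (regular_module R) +>\<^bsub>R\<^esub> r)\<rparr>"

end

theory Submission
  imports Defs
begin

text \<open>
  Let \<open>T\<close> be the torsion submodule of \<open>M\<close>; for the ideals meeting \<open>S\<close> it consists of the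
  elements killed by some \<open>s \<in> S\<close>. Everything rests on the observation that a linear map
  \<open>f : I \<rightarrow> M/T\<close> is determined, as a germ, by its value at a single \<open>s \<in> I \<inter> S\<close>: this
  value fixes \<open>f\<close> on the principal ideal of \<open>s\<close>, which again meets \<open>S\<close>
  (\<open>germ_rel_iff\<close>). If \<open>f s = m + T\<close>, then the germ of \<open>f\<close> should be thought of as the fraction
  \<open>m/s\<close>. Evaluating \<open>f\<close> at \<open>t s\<close>, where \<open>f t = n + T\<close>, shows that \<open>m/s\<close> does not
  depend on the choice of \<open>s\<close> (\<open>local_map_value_unique\<close>). Conversely every \<open>m/s\<close> is the
  value of a map on the principal ideal of \<open>s\<close>, namely \<open>r s \<mapsto> r m + T\<close>; this is
  well defined because \<open>r s = r' s\<close> forces \<open>(r - r') m\<close> to be killed by \<open>s\<close>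
  (\<open>local_map_of_fraction\<close>).

  So the map \<open>fraction_germ\<close>, which sends a fraction to the set of all linear maps
  that represent it, is a bijection onto the germs (\<open>bij_fraction_germ\<close>). It
  respects sums, scalar multiples and, for \<open>M = R\<close>, products, because each of these can be
  read off at one product of denominators. The axioms of modules and of commutative rings
  are checked on fractions, where they are identities between numerators and denominators,
  and are carried over to the germs along the bijection.

  Uniqueness holds because \<open>s\<close> times \<open>m/s\<close> is \<open>m/1\<close>, and elements of \<open>S\<close> act injectively
  on fractions and therefore on germs: a linear map that is prescribed on the elements \<open>m/1\<close>
  is prescribed everywhere (\<open>linear_map_eq_fraction_germ\<close>).
\<close>
section \<open>Transport of structure\<close>

text \<open>
  The hypothesis that \<open>h\<close> sends zero to zero does not follow from additivity here,
  because \<open>B\<close> is only a record until the conclusion is known.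
\<close>
lemma module_transport:
  fixes R (structure) and A (structure) and B (structure)
  assumes A: "module R A"
    and bij: "bij_betw h (carrier A) (carrier B)"
    and h_add: "\<And>x y. x \<in> carrier A \<Longrightarrow> y \<in> carrier A \<Longrightarrow> h (x \<oplus>\<^bsub>A\<^esub> y) = h x \<oplus>\<^bsub>B\<^esub> h y"
    and h_zero: "h \<zero>\<^bsub>A\<^esub> = \<zero>\<^bsub>B\<^esub>"
    and h_smult: "\<And>r x. r \<in> carrier R \<Longrightarrow> x \<in> carrier A \<Longrightarrow> h (r \<odot>\<^bsub>A\<^esub> x) = r \<odot>\<^bsub>B\<^esub> h x"
  shows "module R B"
proof -
  interpret A: module R A by (rule A)
  have carrier: "carrier B = h ` carrier A"
    using bij by (simp add: bij_betw_def)
  note h_simps = h_add[symmetric] h_zero[symmetric] h_smult[symmetric]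
  show ?thesis
  proof (rule moduleI)
    show "cring R" by (rule A.R.is_cring)
    show "abelian_group B"
    proof (rule abelian_groupI)
      fix y assume "y \<in> carrier B"
      then obtain x where "x \<in> carrier A" "y = h x" by (auto simp: carrier)
      then show "\<exists>z\<in>carrier B. z \<oplus>\<^bsub>B\<^esub> y = \<zero>\<^bsub>B\<^esub>"
        by (intro bexI[of _ "h (\<ominus>\<^bsub>A\<^esub> x)"]) (auto simp: carrier h_simps A.M.l_neg)
    qed (auto simp: carrier h_simps A.M.a_ac)
  qed (auto simp: carrier h_simps A.smult_l_distr A.smult_r_distr A.smult_assoc1)
qed

lemma cring_transport:
  assumes "cring A" and iso: "h \<in> ring_iso A B" and zero: "h \<zero>\<^bsub>A\<^esub> = \<zero>\<^bsub>B\<^esub>"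
  shows "cring B"
  using cring.ring_iso_imp_img_cring[OF \<open>cring A\<close> iso] by (simp add: zero)

text \<open>
  Operations on classes are defined as unions over representatives; such a union collapses
  to its common value once independence of the representatives is known.
\<close>
lemma UN_pairs_const:
  assumes "X \<noteq> {}" and "\<And>a b. (a, b) \<in> X \<Longrightarrow> h a b = C"
  shows "(\<Union>(a, b)\<in>X. h a b) = C"
  using assms by fastforce

lemma UN_pairs_const2:
  assumes "X \<noteq> {}" and "Y \<noteq> {}"
    and "\<And>a b c d. (a, b) \<in> X \<Longrightarrow> (c, d) \<in> Y \<Longrightarrow> h a b c d = C"
  shows "(\<Union>(a, b)\<in>X. \<Union>(c, d)\<in>Y. h a b c d) = C"
  using assms by (intro UN_pairs_const) auto


section \<open>Fractions\<close>

locale fractions = module R M for R (structure) and M (structure) +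
  fixes S
  assumes submonoid: "submonoid S R"
begin

lemma S_carrier [simp, intro]: "s \<in> S \<Longrightarrow> s \<in> carrier R"
  and S_mult [simp, intro]: "s \<in> S \<Longrightarrow> t \<in> S \<Longrightarrow> s \<otimes> t \<in> S"
  and S_one [simp, intro]: "\<one> \<in> S"
  using submonoid by (auto simp: submonoid_def)

lemma smult_lcomm:
  "a \<in> carrier R \<Longrightarrow> b \<in> carrier R \<Longrightarrow> x \<in> carrier M \<Longrightarrow> a \<odot>\<^bsub>M\<^esub> (b \<odot>\<^bsub>M\<^esub> x) = b \<odot>\<^bsub>M\<^esub> (a \<odot>\<^bsub>M\<^esub> x)"
  by (metis R.m_comm smult_assoc1)

lemma equiv_fraction_rel: "equiv (carrier M \<times> S) (fraction_rel S M)"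
proof (rule equivI)
  show "fraction_rel S M \<subseteq> (carrier M \<times> S) \<times> carrier M \<times> S"
    by (auto simp: fraction_rel_def)
  show "refl_on (carrier M \<times> S) (fraction_rel S M)"
    by (auto simp: refl_on_def fraction_rel_def)
  show "sym (fraction_rel S M)"
    by (rule symI) (auto simp: fraction_rel_def dest: sym)
  show "trans (fraction_rel S M)"
  proof (rule transI, clarify)
    fix l s m t n v
    assume 1: "((l, s), (m, t)) \<in> fraction_rel S M" and 2: "((m, t), (n, v)) \<in> fraction_rel S M"
    then have [simp]: "l \<in> carrier M" "m \<in> carrier M" "n \<in> carrier M" "s \<in> S" "t \<in> S" "v \<in> S"
      by (auto simp: fraction_rel_def)
    from 1 obtain p where [simp]: "p \<in> S" and p: "p \<odot>\<^bsub>M\<^esub> (t \<odot>\<^bsub>M\<^esub> l) = p \<odot>\<^bsub>M\<^esub> (s \<odot>\<^bsub>M\<^esub> m)"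
      by (auto simp: fraction_rel_def)
    from 2 obtain q where [simp]: "q \<in> S" and q: "q \<odot>\<^bsub>M\<^esub> (v \<odot>\<^bsub>M\<^esub> m) = q \<odot>\<^bsub>M\<^esub> (t \<odot>\<^bsub>M\<^esub> n)"
      by (auto simp: fraction_rel_def)
    have "(p \<otimes> q \<otimes> t) \<odot>\<^bsub>M\<^esub> (v \<odot>\<^bsub>M\<^esub> l) = q \<odot>\<^bsub>M\<^esub> (v \<odot>\<^bsub>M\<^esub> (p \<odot>\<^bsub>M\<^esub> (t \<odot>\<^bsub>M\<^esub> l)))"
      by (simp add: smult_assoc1 smult_lcomm)
    also have "\<dots> = p \<odot>\<^bsub>M\<^esub> (s \<odot>\<^bsub>M\<^esub> (q \<odot>\<^bsub>M\<^esub> (v \<odot>\<^bsub>M\<^esub> m)))"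
      by (simp add: p smult_lcomm)
    also have "\<dots> = (p \<otimes> q \<otimes> t) \<odot>\<^bsub>M\<^esub> (s \<odot>\<^bsub>M\<^esub> n)"
      by (simp add: q smult_assoc1 smult_lcomm)
    finally show "((l, s), (n, v)) \<in> fraction_rel S M"
      by (auto simp: fraction_rel_def intro!: bexI[of _ "p \<otimes> q \<otimes> t"])
  qed
qed

lemma fraction_eq_iff:
  assumes "m \<in> carrier M" "n \<in> carrier M" "s \<in> S" "t \<in> S"
  shows "fraction S M m s = fraction S M n t \<longleftrightarrow> (\<exists>u\<in>S. u \<odot>\<^bsub>M\<^esub> (t \<odot>\<^bsub>M\<^esub> m) = u \<odot>\<^bsub>M\<^esub> (s \<odot>\<^bsub>M\<^esub> n))"
  unfolding fraction_def
  by (subst eq_equiv_class_iff[OF equiv_fraction_rel]) (use assms in \<open>auto simp: fraction_rel_def\<close>)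

lemma fraction_eqI:
  assumes "m \<in> carrier M" "n \<in> carrier M" "s \<in> S" "t \<in> S" "t \<odot>\<^bsub>M\<^esub> m = s \<odot>\<^bsub>M\<^esub> n"
  shows "fraction S M m s = fraction S M n t"
  using assms by (auto simp: fraction_eq_iff)

lemma fraction_self: "m \<in> carrier M \<Longrightarrow> s \<in> S \<Longrightarrow> (m, s) \<in> fraction S M m s"
  unfolding fraction_def by (rule equiv_class_self[OF equiv_fraction_rel]) auto

lemma mem_fraction:
  assumes "m \<in> carrier M" "s \<in> S" "(n, t) \<in> fraction S M m s"
  shows "n \<in> carrier M" "t \<in> S" "fraction S M n t = fraction S M m s"
proof -
  have rel: "((m, s), (n, t)) \<in> fraction_rel S M"
    using assms by (simp add: fraction_def)
  then show "n \<in> carrier M" "t \<in> S" by (auto simp: fraction_rel_def)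
  show "fraction S M n t = fraction S M m s"
    unfolding fraction_def using equiv_class_eq[OF equiv_fraction_rel rel] by simp
qed

lemma fraction_closed [simp]:
  "m \<in> carrier M \<Longrightarrow> s \<in> S \<Longrightarrow> fraction S M m s \<in> carrier (fraction_module R S M)"
  by (auto simp: fraction_module_def fraction_def intro!: quotientI)

lemma fraction_cases:
  assumes "X \<in> carrier (fraction_module R S M)"
  obtains m s where "m \<in> carrier M" "s \<in> S" "X = fraction S M m s"
  using assms by (auto simp: fraction_module_def fraction_def elim!: quotientE)

text \<open>
  Together with commutativity this is what brings two fractions to a common denominator.
\<close>
lemma fraction_cancel:
  "m \<in> carrier M \<Longrightarrow> s \<in> S \<Longrightarrow> u \<in> S \<Longrightarrow> fraction S M (u \<odot>\<^bsub>M\<^esub> m) (u \<otimes> s) = fraction S M m s"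
  by (rule fraction_eqI) (auto simp: smult_assoc1 smult_lcomm)

lemma fraction_add:
  assumes [simp]: "m \<in> carrier M" "n \<in> carrier M" "s \<in> S" "t \<in> S"
  shows "fraction S M m s \<oplus>\<^bsub>fraction_module R S M\<^esub> fraction S M n t =
    fraction S M ((t \<odot>\<^bsub>M\<^esub> m) \<oplus>\<^bsub>M\<^esub> (s \<odot>\<^bsub>M\<^esub> n)) (s \<otimes> t)"
  unfolding fraction_module_def ring.simps
proof (rule UN_pairs_const2)
  fix m' s' n' t' assume X: "(m', s') \<in> fraction S M m s" and Y: "(n', t') \<in> fraction S M n t"
  from mem_fraction[OF _ _ X] mem_fraction[OF _ _ Y]
  have [simp]: "m' \<in> carrier M" "n' \<in> carrier M" "s' \<in> S" "t' \<in> S" and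
    eqs: "fraction S M m' s' = fraction S M m s" "fraction S M n' t' = fraction S M n t" by auto
  from eqs(1) obtain u where [simp]: "u \<in> S" and u: "u \<odot>\<^bsub>M\<^esub> (s \<odot>\<^bsub>M\<^esub> m') = u \<odot>\<^bsub>M\<^esub> (s' \<odot>\<^bsub>M\<^esub> m)"
    by (subst (asm) fraction_eq_iff) auto
  from eqs(2) obtain v where [simp]: "v \<in> S" and v: "v \<odot>\<^bsub>M\<^esub> (t \<odot>\<^bsub>M\<^esub> n') = v \<odot>\<^bsub>M\<^esub> (t' \<odot>\<^bsub>M\<^esub> n)"
    by (subst (asm) fraction_eq_iff) auto
  have "(u \<otimes> v) \<odot>\<^bsub>M\<^esub> ((s \<otimes> t) \<odot>\<^bsub>M\<^esub> (t' \<odot>\<^bsub>M\<^esub> m' \<oplus>\<^bsub>M\<^esub> s' \<odot>\<^bsub>M\<^esub> n')) =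
     v \<odot>\<^bsub>M\<^esub> (t \<odot>\<^bsub>M\<^esub> (t' \<odot>\<^bsub>M\<^esub> (u \<odot>\<^bsub>M\<^esub> (s \<odot>\<^bsub>M\<^esub> m')))) \<oplus>\<^bsub>M\<^esub> u \<odot>\<^bsub>M\<^esub> (s \<odot>\<^bsub>M\<^esub> (s' \<odot>\<^bsub>M\<^esub> (v \<odot>\<^bsub>M\<^esub> (t \<odot>\<^bsub>M\<^esub> n'))))"
    by (simp add: smult_r_distr smult_assoc1 smult_lcomm)
  also have "\<dots> = (u \<otimes> v) \<odot>\<^bsub>M\<^esub> ((s' \<otimes> t') \<odot>\<^bsub>M\<^esub> (t \<odot>\<^bsub>M\<^esub> m \<oplus>\<^bsub>M\<^esub> s \<odot>\<^bsub>M\<^esub> n))"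
    by (simp add: u v smult_r_distr smult_assoc1 smult_lcomm)
  finally show "fraction S M (t' \<odot>\<^bsub>M\<^esub> m' \<oplus>\<^bsub>M\<^esub> s' \<odot>\<^bsub>M\<^esub> n') (s' \<otimes> t') =
      fraction S M (t \<odot>\<^bsub>M\<^esub> m \<oplus>\<^bsub>M\<^esub> s \<odot>\<^bsub>M\<^esub> n) (s \<otimes> t)"
    by (subst fraction_eq_iff) (auto intro!: bexI[of _ "u \<otimes> v"])
qed (use fraction_self assms in blast)+

lemma fraction_smult:
  assumes [simp]: "r \<in> carrier R" "m \<in> carrier M" "s \<in> S"
  shows "r \<odot>\<^bsub>fraction_module R S M\<^esub> fraction S M m s = fraction S M (r \<odot>\<^bsub>M\<^esub> m) s"
  unfolding fraction_module_def module.simps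
proof (rule UN_pairs_const)
  fix m' s' assume X: "(m', s') \<in> fraction S M m s"
  from mem_fraction[OF _ _ X]
  have [simp]: "m' \<in> carrier M" "s' \<in> S" and "fraction S M m' s' = fraction S M m s" by auto
  then obtain u where [simp]: "u \<in> S" and u: "u \<odot>\<^bsub>M\<^esub> (s \<odot>\<^bsub>M\<^esub> m') = u \<odot>\<^bsub>M\<^esub> (s' \<odot>\<^bsub>M\<^esub> m)"
    by (subst (asm) fraction_eq_iff) auto
  have "u \<odot>\<^bsub>M\<^esub> (s \<odot>\<^bsub>M\<^esub> (r \<odot>\<^bsub>M\<^esub> m')) = r \<odot>\<^bsub>M\<^esub> (u \<odot>\<^bsub>M\<^esub> (s \<odot>\<^bsub>M\<^esub> m'))"
    by (simp add: smult_lcomm)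
  also have "\<dots> = u \<odot>\<^bsub>M\<^esub> (s' \<odot>\<^bsub>M\<^esub> (r \<odot>\<^bsub>M\<^esub> m))"
    by (simp add: u smult_lcomm)
  finally show "fraction S M (r \<odot>\<^bsub>M\<^esub> m') s' = fraction S M (r \<odot>\<^bsub>M\<^esub> m) s"
    by (subst fraction_eq_iff) auto
qed (use fraction_self assms in blast)

lemma zero_fraction_eq: "s \<in> S \<Longrightarrow> fraction S M \<zero>\<^bsub>M\<^esub> s = fraction S M \<zero>\<^bsub>M\<^esub> \<one>"
  by (rule fraction_eqI) auto

lemma fraction_zero: "\<zero>\<^bsub>fraction_module R S M\<^esub> = fraction S M \<zero>\<^bsub>M\<^esub> \<one>"
  by (simp add: fraction_module_def)

lemma module_fraction_module: "module R (fraction_module R S M)"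
proof (rule moduleI)
  show "cring R" by (rule R.is_cring)
  show "abelian_group (fraction_module R S M)"
  proof (rule abelian_groupI)
    fix X assume "X \<in> carrier (fraction_module R S M)"
    then obtain m s where "m \<in> carrier M" "s \<in> S" "X = fraction S M m s"
      by (rule fraction_cases)
    then have "fraction S M (\<ominus>\<^bsub>M\<^esub> m) s \<oplus>\<^bsub>fraction_module R S M\<^esub> X = \<zero>\<^bsub>fraction_module R S M\<^esub>"
      by (simp add: fraction_add fraction_zero smult_r_minus M.l_neg zero_fraction_eq[of "s \<otimes> s"])
    then show "\<exists>Y\<in>carrier (fraction_module R S M). Y \<oplus>\<^bsub>fraction_module R S M\<^esub> X = \<zero>\<^bsub>fraction_module R S M\<^esub>"
      using \<open>m \<in> carrier M\<close> \<open>s \<in> S\<close> by (intro bexI[of _ "fraction S M (\<ominus>\<^bsub>M\<^esub> m) s"]) auto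
  qed (auto elim!: fraction_cases simp: fraction_add fraction_zero smult_r_distr
      smult_assoc1 smult_lcomm R.m_ac M.a_ac)
next
  fix a b X assume [simp]: "a \<in> carrier R" "b \<in> carrier R" and "X \<in> carrier (fraction_module R S M)"
  then obtain m s where [simp]: "m \<in> carrier M" "s \<in> S" and X: "X = fraction S M m s"
    by (auto elim: fraction_cases)
  have "fraction S M (s \<odot>\<^bsub>M\<^esub> (a \<odot>\<^bsub>M\<^esub> m) \<oplus>\<^bsub>M\<^esub> s \<odot>\<^bsub>M\<^esub> (b \<odot>\<^bsub>M\<^esub> m)) (s \<otimes> s) = fraction S M ((a \<oplus> b) \<odot>\<^bsub>M\<^esub> m) s"
    using fraction_cancel[of "(a \<oplus> b) \<odot>\<^bsub>M\<^esub> m" s s] by (simp add: smult_l_distr smult_r_distr)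
  then show "(a \<oplus> b) \<odot>\<^bsub>fraction_module R S M\<^esub> X =
      a \<odot>\<^bsub>fraction_module R S M\<^esub> X \<oplus>\<^bsub>fraction_module R S M\<^esub> b \<odot>\<^bsub>fraction_module R S M\<^esub> X"
    by (simp add: X fraction_smult fraction_add)
qed (auto elim!: fraction_cases simp: fraction_add fraction_smult smult_r_distr
      smult_assoc1 smult_lcomm)

lemma smult_fraction_eq_map:
  "m \<in> carrier M \<Longrightarrow> s \<in> S \<Longrightarrow> s \<odot>\<^bsub>fraction_module R S M\<^esub> fraction S M m s = fraction_map R S M m"
  using fraction_cancel[of m \<one> s] by (simp add: fraction_smult fraction_map_def)

text \<open>
  Each \<open>s \<in> S\<close> acts injectively on fractions, since it can be absorbed into the factor
  \<open>u\<close> that witnesses the equality of two fractions.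
\<close>
lemma smult_fraction_module_cancel:
  assumes "s \<in> S" and "X \<in> carrier (fraction_module R S M)" and "Y \<in> carrier (fraction_module R S M)"
    and "s \<odot>\<^bsub>fraction_module R S M\<^esub> X = s \<odot>\<^bsub>fraction_module R S M\<^esub> Y"
  shows "X = Y"
proof -
  from assms obtain m t n v where [simp]: "s \<in> S" "m \<in> carrier M" "t \<in> S" "n \<in> carrier M" "v \<in> S"
    and XY: "X = fraction S M m t" "Y = fraction S M n v"
    by (auto elim!: fraction_cases)
  with assms(4) obtain u where "u \<in> S" "u \<odot>\<^bsub>M\<^esub> (v \<odot>\<^bsub>M\<^esub> (s \<odot>\<^bsub>M\<^esub> m)) = u \<odot>\<^bsub>M\<^esub> (t \<odot>\<^bsub>M\<^esub> (s \<odot>\<^bsub>M\<^esub> n))"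
    by (auto simp: fraction_smult fraction_eq_iff)
  then show ?thesis
    by (auto simp: XY fraction_eq_iff smult_assoc1 smult_lcomm intro!: bexI[of _ "u \<otimes> s"])
qed


section \<open>The quotient by the torsion submodule\<close>

abbreviation F where "F \<equiv> ideals_meeting R S"
abbreviation T where "T \<equiv> torsion R F M"
abbreviation Q where "Q \<equiv> torsion_quotient R F M"

lemma annihilator_ideal:
  assumes "m \<in> carrier M" shows "ideal (annihilator R M m) R"
proof (rule idealI)
  show "ring R" by (rule R.ring_axioms)
  show "subgroup (annihilator R M m) (add_monoid R)"
  proof (rule R.add.subgroupI)
    show "annihilator R M m \<noteq> {}"
      using assms by (auto simp: annihilator_def intro!: exI[of _ \<zero>])
  qed (use assms in \<open>auto simp: annihilator_def smult_l_distr smult_l_minus simp flip: a_inv_def\<close>)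
next
  fix a x assume "a \<in> annihilator R M m" "x \<in> carrier R"
  then show "x \<otimes> a \<in> annihilator R M m" "a \<otimes> x \<in> annihilator R M m"
    using assms by (auto simp: annihilator_def smult_assoc1 R.m_comm[of a x])
qed

text \<open>
  Membership in \<open>T\<close> means that the annihilator meets \<open>S\<close>; that the annihilator is an
  ideal is automatic.
\<close>
lemma torsion_iff: "m \<in> T \<longleftrightarrow> m \<in> carrier M \<and> (\<exists>s\<in>S. s \<odot>\<^bsub>M\<^esub> m = \<zero>\<^bsub>M\<^esub>)"
  using annihilator_ideal by (auto simp: torsion_def ideals_meeting_def annihilator_def)

lemma torsion_subgroup: "abelian_subgroup T M"
proof (rule abelian_subgroupI3)
  show "additive_subgroup T M"
  proof (rule additive_subgroup.intro, rule M.add.subgroupI)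
    show "T \<subseteq> carrier M" by (auto simp: torsion_iff)
    have "\<zero>\<^bsub>M\<^esub> \<in> T" by (auto simp: torsion_iff)
    then show "T \<noteq> {}" by auto
    fix x assume x: "x \<in> T"
    then show "\<ominus>\<^bsub>M\<^esub> x \<in> T"
      by (auto simp: torsion_iff smult_r_minus)
    fix y assume y: "y \<in> T"
    from x y obtain s t where "s \<in> S" "t \<in> S" "x \<in> carrier M" "y \<in> carrier M"
      "s \<odot>\<^bsub>M\<^esub> x = \<zero>\<^bsub>M\<^esub>" "t \<odot>\<^bsub>M\<^esub> y = \<zero>\<^bsub>M\<^esub>" by (auto simp: torsion_iff)
    then have "(s \<otimes> t) \<odot>\<^bsub>M\<^esub> (x \<oplus>\<^bsub>M\<^esub> y) = \<zero>\<^bsub>M\<^esub>"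
      by (simp add: smult_r_distr smult_assoc1 smult_lcomm[of s t x])
    then show "x \<oplus>\<^bsub>M\<^esub> y \<in> T"
      using \<open>s \<in> S\<close> \<open>t \<in> S\<close> \<open>x \<in> carrier M\<close> \<open>y \<in> carrier M\<close>
      by (auto simp: torsion_iff intro!: bexI[of _ "s \<otimes> t"])
  qed
qed (rule M.abelian_group_axioms)

interpretation T: abelian_subgroup T M by (rule torsion_subgroup)

text \<open>
  Two cosets agree iff the difference of their representatives is torsion, which turns
  equality in the quotient into an equality in \<open>M\<close> after multiplication by some \<open>s \<in> S\<close>.
\<close>
lemma coset_eq_iff:
  assumes [simp]: "x \<in> carrier M" "y \<in> carrier M"
  shows "T +>\<^bsub>M\<^esub> x = T +>\<^bsub>M\<^esub> y \<longleftrightarrow> (\<exists>s\<in>S. s \<odot>\<^bsub>M\<^esub> x = s \<odot>\<^bsub>M\<^esub> y)"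
proof -
  have "T +>\<^bsub>M\<^esub> x = T +>\<^bsub>M\<^esub> y \<longleftrightarrow> x \<in> T +>\<^bsub>M\<^esub> y"
    using T.a_rcos_self[of x] M.a_repr_independence[OF _ _ T.a_subgroup, of x y] assms by blast
  also have "\<dots> \<longleftrightarrow> x \<ominus>\<^bsub>M\<^esub> y \<in> T"
    by (simp add: T.a_rcos_module a_minus_def)
  also have "\<dots> \<longleftrightarrow> (\<exists>s\<in>S. s \<odot>\<^bsub>M\<^esub> x \<ominus>\<^bsub>M\<^esub> s \<odot>\<^bsub>M\<^esub> y = \<zero>\<^bsub>M\<^esub>)"
    by (auto simp: torsion_iff a_minus_def smult_r_distr smult_r_minus)
  also have "\<dots> \<longleftrightarrow> (\<exists>s\<in>S. s \<odot>\<^bsub>M\<^esub> x = s \<odot>\<^bsub>M\<^esub> y)"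
  proof (rule bex_cong[OF refl])
    fix s assume "s \<in> S"
    then show "s \<odot>\<^bsub>M\<^esub> x \<ominus>\<^bsub>M\<^esub> s \<odot>\<^bsub>M\<^esub> y = \<zero>\<^bsub>M\<^esub> \<longleftrightarrow> s \<odot>\<^bsub>M\<^esub> x = s \<odot>\<^bsub>M\<^esub> y"
      using M.minus_equality[of "s \<odot>\<^bsub>M\<^esub> x" "\<ominus>\<^bsub>M\<^esub> (s \<odot>\<^bsub>M\<^esub> y)"] by (auto simp: a_minus_def M.r_neg)
  qed
  finally show ?thesis .
qed

lemma coset_in_Q [simp]: "x \<in> carrier M \<Longrightarrow> T +>\<^bsub>M\<^esub> x \<in> carrier Q"
  by (auto simp: torsion_quotient_def quotient_module_def A_RCOSETS_def')

lemma Q_cases: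
  assumes "X \<in> carrier Q"
  obtains x where "x \<in> carrier M" "X = T +>\<^bsub>M\<^esub> x"
  using assms by (auto simp: torsion_quotient_def quotient_module_def A_RCOSETS_def')

lemma Q_zero: "\<zero>\<^bsub>Q\<^esub> = T +>\<^bsub>M\<^esub> \<zero>\<^bsub>M\<^esub>"
  by (simp add: torsion_quotient_def quotient_module_def T.a_subset)

lemma Q_add:
  "x \<in> carrier M \<Longrightarrow> y \<in> carrier M \<Longrightarrow> (T +>\<^bsub>M\<^esub> x) \<oplus>\<^bsub>Q\<^esub> (T +>\<^bsub>M\<^esub> y) = T +>\<^bsub>M\<^esub> (x \<oplus>\<^bsub>M\<^esub> y)"
  by (simp add: torsion_quotient_def quotient_module_def T.a_rcos_sum)

lemma Q_smult:
  assumes [simp]: "r \<in> carrier R" "x \<in> carrier M"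
  shows "r \<odot>\<^bsub>Q\<^esub> (T +>\<^bsub>M\<^esub> x) = T +>\<^bsub>M\<^esub> (r \<odot>\<^bsub>M\<^esub> x)"
proof -
  have "T +>\<^bsub>M\<^esub> (r \<odot>\<^bsub>M\<^esub> y) = T +>\<^bsub>M\<^esub> (r \<odot>\<^bsub>M\<^esub> x)" if "y \<in> T +>\<^bsub>M\<^esub> x" for y
  proof -
    have [simp]: "y \<in> carrier M" using subsetD[OF M.a_r_coset_subset_G[OF T.a_subset] that] by simp
    have "T +>\<^bsub>M\<^esub> y = T +>\<^bsub>M\<^esub> x"
      using M.a_repr_independence[OF that _ T.a_subgroup] by simp
    then obtain s where "s \<in> S" "s \<odot>\<^bsub>M\<^esub> y = s \<odot>\<^bsub>M\<^esub> x" by (auto simp: coset_eq_iff)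
    then show ?thesis by (auto simp: coset_eq_iff smult_lcomm[of _ r] intro!: bexI[of _ s])
  qed
  moreover have "x \<in> T +>\<^bsub>M\<^esub> x" by (simp add: T.a_rcos_self)
  ultimately have "(\<Union>y\<in>T +>\<^bsub>M\<^esub> x. T +>\<^bsub>M\<^esub> (r \<odot>\<^bsub>M\<^esub> y)) = T +>\<^bsub>M\<^esub> (r \<odot>\<^bsub>M\<^esub> x)"
    by blast
  then show ?thesis
    by (simp add: torsion_quotient_def quotient_module_def)
qed

lemma module_Q: "module R Q"
proof (rule moduleI)
  show "cring R" by (rule R.is_cring)
  show "abelian_group Q"
  proof (rule abelian_groupI)
    fix X assume "X \<in> carrier Q"
    then obtain x where "x \<in> carrier M" "X = T +>\<^bsub>M\<^esub> x" by (rule Q_cases)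
    then show "\<exists>Y\<in>carrier Q. Y \<oplus>\<^bsub>Q\<^esub> X = \<zero>\<^bsub>Q\<^esub>"
      by (intro bexI[of _ "T +>\<^bsub>M\<^esub> (\<ominus>\<^bsub>M\<^esub> x)"]) (auto simp: Q_add Q_zero M.l_neg)
  qed (auto elim!: Q_cases simp: Q_add Q_zero M.a_ac)
qed (auto elim!: Q_cases simp: Q_add Q_smult smult_l_distr smult_r_distr smult_assoc1)

interpretation Q: module R Q by (rule module_Q)

text \<open>
  Dividing by \<open>T\<close> leaves no torsion, because \<open>S\<close> is closed under products: if \<open>u\<close> kills
  \<open>s x\<close>, then \<open>u s\<close> kills \<open>x\<close>. The product of germs of \<open>R\<close> is well defined for this reason.
\<close>
lemma Q_torsion_free:
  assumes "s \<in> S" "X \<in> carrier Q" "Y \<in> carrier Q" "s \<odot>\<^bsub>Q\<^esub> X = s \<odot>\<^bsub>Q\<^esub> Y"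
  shows "X = Y"
proof -
  obtain x y where [simp]: "x \<in> carrier M" "y \<in> carrier M" and XY: "X = T +>\<^bsub>M\<^esub> x" "Y = T +>\<^bsub>M\<^esub> y"
    using assms(2,3) by (auto elim!: Q_cases)
  obtain u where "u \<in> S" "u \<odot>\<^bsub>M\<^esub> (s \<odot>\<^bsub>M\<^esub> x) = u \<odot>\<^bsub>M\<^esub> (s \<odot>\<^bsub>M\<^esub> y)"
    using assms(1,4) by (auto simp: XY Q_smult coset_eq_iff)
  then show ?thesis
    using \<open>s \<in> S\<close> by (auto simp: XY coset_eq_iff smult_assoc1 intro!: bexI[of _ "u \<otimes> s"])
qed


section \<open>Germs of linear maps\<close>

lemma carrier_in_F: "carrier R \<in> F"
  using R.oneideal by (auto simp: ideals_meeting_def)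

lemma local_mapsI:
  assumes "I \<in> F"
    and "\<And>a. a \<in> I \<Longrightarrow> f a \<in> carrier Q"
    and "\<And>a b. a \<in> I \<Longrightarrow> b \<in> I \<Longrightarrow> f (a \<oplus> b) = f a \<oplus>\<^bsub>Q\<^esub> f b"
    and "\<And>r a. r \<in> carrier R \<Longrightarrow> a \<in> I \<Longrightarrow> f (r \<otimes> a) = r \<odot>\<^bsub>Q\<^esub> f a"
  shows "(I, restrict f I) \<in> local_maps R F M"
proof -
  interpret I: ideal I R using assms(1) by (simp add: ideals_meeting_def)
  show ?thesis
    using assms by (auto simp: local_maps_def linear_maps_def regular_module_def I.I_l_closed)
qed

lemma local_mapsD:
  assumes "(I, f) \<in> local_maps R F M"
  shows "I \<in> F" and "ideal I R"
    and "\<And>a. a \<in> I \<Longrightarrow> f a \<in> carrier Q"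
    and "\<And>a b. a \<in> I \<Longrightarrow> b \<in> I \<Longrightarrow> f (a \<oplus> b) = f a \<oplus>\<^bsub>Q\<^esub> f b"
    and "\<And>r a. r \<in> carrier R \<Longrightarrow> a \<in> I \<Longrightarrow> f (r \<otimes> a) = r \<odot>\<^bsub>Q\<^esub> f a"
    and "restrict f I = f"
  using assms by (auto simp: local_maps_def linear_maps_def regular_module_def ideals_meeting_def
      extensional_restrict)

lemma local_maps_scale:
  assumes "(I, f) \<in> local_maps R F M" "s \<in> I" "r \<in> carrier R" "m \<in> carrier M" "f s = T +>\<^bsub>M\<^esub> m"
  shows "r \<otimes> s \<in> I" and "f (r \<otimes> s) = T +>\<^bsub>M\<^esub> (r \<odot>\<^bsub>M\<^esub> m)"
  using assms local_mapsD[OF assms(1)] by (auto simp: Q_smult ideal.I_l_closed)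

text \<open>
  Agreement on a whole ideal in \<open>F\<close> reduces to agreement at one element of \<open>S\<close>: linearity
  spreads the equality \<open>f s = g s\<close> over the principal ideal of \<open>s\<close>.
\<close>
lemma germ_rel_iff:
  "((I, f), (J, g)) \<in> germ_rel R F M \<longleftrightarrow>
    (I, f) \<in> local_maps R F M \<and> (J, g) \<in> local_maps R F M \<and> (\<exists>s\<in>S \<inter> I \<inter> J. f s = g s)"
proof (intro iffI conjI)
  assume rhs: "(I, f) \<in> local_maps R F M \<and> (J, g) \<in> local_maps R F M \<and> (\<exists>s\<in>S \<inter> I \<inter> J. f s = g s)"
  then obtain s where s: "s \<in> S" "s \<in> I" "s \<in> J" "f s = g s" by auto
  note If = local_mapsD[OF conjunct1[OF rhs]] and Jg = local_mapsD[OF conjunct1[OF conjunct2[OF rhs]]]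
  have "cgenideal R s \<in> F"
    using s R.cgenideal_ideal[of s] R.cgenideal_self[of s] by (auto simp: ideals_meeting_def)
  moreover have "cgenideal R s \<subseteq> I \<inter> J"
    using R.cgenideal_minimal s If(2) Jg(2) by blast
  moreover have "\<forall>a\<in>cgenideal R s. f a = g a"
    using s If(5) Jg(5) by (auto simp: cgenideal_def)
  ultimately show "((I, f), (J, g)) \<in> germ_rel R F M"
    using rhs by (auto simp: germ_rel_def)
qed (auto simp: germ_rel_def ideals_meeting_def, blast)


section \<open>Fractions as germs\<close>

text \<open>
  The whole class is written down as a set: the pair \<open>(I, f)\<close> represents \<open>m/s\<close> when \<open>f\<close> takes
  the value \<open>m + T\<close> at \<open>s \<in> I\<close> for some way of writing the fraction. This avoids choosing
  representatives on either side, and \<open>fraction_germ_eq\<close> shows that the set is a germ.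
\<close>
definition fraction_germ where
  "fraction_germ X =
    {(I, f). (I, f) \<in> local_maps R F M \<and> (\<exists>(m, s)\<in>X. s \<in> I \<and> f s = T +>\<^bsub>M\<^esub> m)}"

text \<open>
  Both values are compared at \<open>t s\<close>, where \<open>f\<close> equals \<open>t m + T\<close> as well as \<open>s n + T\<close>.
\<close>
lemma local_map_value_unique:
  assumes If: "(I, f) \<in> local_maps R F M"
    and [simp]: "m \<in> carrier M" "n \<in> carrier M" "s \<in> S" "t \<in> S"
    and s: "s \<in> I" "f s = T +>\<^bsub>M\<^esub> m" and t: "t \<in> I" "f t = T +>\<^bsub>M\<^esub> n"
  shows "fraction S M m s = fraction S M n t"
proof -
  have "T +>\<^bsub>M\<^esub> (t \<odot>\<^bsub>M\<^esub> m) = f (t \<otimes> s)"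
    using local_maps_scale[OF If s(1) _ _ s(2)] by simp
  also have "\<dots> = T +>\<^bsub>M\<^esub> (s \<odot>\<^bsub>M\<^esub> n)"
    using local_maps_scale[OF If t(1) _ _ t(2), of s] by (simp add: R.m_comm)
  finally show ?thesis by (simp add: coset_eq_iff fraction_eq_iff)
qed

lemma local_map_fraction_exists:
  assumes "(I, f) \<in> local_maps R F M"
  obtains m s where "m \<in> carrier M" "s \<in> S" "s \<in> I" "f s = T +>\<^bsub>M\<^esub> m"
proof -
  from local_mapsD(1)[OF assms] obtain s where "s \<in> S" "s \<in> I" by (auto simp: ideals_meeting_def)
  moreover obtain m where "m \<in> carrier M" "f s = T +>\<^bsub>M\<^esub> m"
    using local_mapsD(3)[OF assms \<open>s \<in> I\<close>] by (rule Q_cases)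
  ultimately show ?thesis by (intro that)
qed

text \<open>
  The map is \<open>r s \<mapsto> r m + T\<close> on the principal ideal of \<open>s\<close>. The factor \<open>r\<close> need not be
  unique, but two choices differ by a multiplier killed by \<open>s\<close>, so that the coset does not change.
\<close>
lemma local_map_of_fraction:
  assumes [simp]: "m \<in> carrier M" "s \<in> S"
  obtains I f where "(I, f) \<in> local_maps R F M" "s \<in> I" "f s = T +>\<^bsub>M\<^esub> m"
proof -
  define f where "f a = T +>\<^bsub>M\<^esub> ((SOME r. r \<in> carrier R \<and> a = r \<otimes> s) \<odot>\<^bsub>M\<^esub> m)" for a
  have f: "f (r \<otimes> s) = T +>\<^bsub>M\<^esub> (r \<odot>\<^bsub>M\<^esub> m)" if [simp]: "r \<in> carrier R" for r
  proof -
    define q where "q = (SOME q. q \<in> carrier R \<and> r \<otimes> s = q \<otimes> s)"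
    have "q \<in> carrier R \<and> r \<otimes> s = q \<otimes> s"
      unfolding q_def by (rule someI[of _ r]) simp
    then have [simp]: "q \<in> carrier R" and "(s \<otimes> q) \<odot>\<^bsub>M\<^esub> m = (s \<otimes> r) \<odot>\<^bsub>M\<^esub> m"
      by (auto simp: R.m_comm)
    then have "s \<odot>\<^bsub>M\<^esub> (q \<odot>\<^bsub>M\<^esub> m) = s \<odot>\<^bsub>M\<^esub> (r \<odot>\<^bsub>M\<^esub> m)"
      by (simp add: smult_assoc1)
    then show ?thesis
      unfolding f_def q_def[symmetric] by (auto simp: coset_eq_iff)
  qed
  let ?I = "cgenideal R s"
  have self: "s \<in> ?I" by (simp add: R.cgenideal_self)
  have "(?I, restrict f ?I) \<in> local_maps R F M"
  proof (rule local_mapsI)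
    show "?I \<in> F"
      using R.cgenideal_ideal[of s] self by (auto simp: ideals_meeting_def)
  next
    fix a b assume "a \<in> ?I" "b \<in> ?I"
    then show "f (a \<oplus> b) = f a \<oplus>\<^bsub>Q\<^esub> f b"
      by (auto simp: cgenideal_def f Q_add smult_l_distr simp flip: R.l_distr)
  next
    fix r a assume "r \<in> carrier R" "a \<in> ?I"
    then show "f (r \<otimes> a) = r \<odot>\<^bsub>Q\<^esub> f a"
      by (auto simp: cgenideal_def f Q_smult smult_assoc1 simp flip: R.m_assoc)
  qed (auto simp: cgenideal_def f)
  moreover have "restrict f ?I s = T +>\<^bsub>M\<^esub> m"
    using self f[of \<one>] by simp
  ultimately show ?thesis using that self by blast
qed

text \<open>
  One inclusion says that maps representing the same fraction agree at a common element of
  \<open>S\<close>, the other that a map equivalent to \<open>f\<close> represents the same fraction as \<open>f\<close>.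
\<close>
lemma fraction_germ_eq:
  assumes If: "(I, f) \<in> local_maps R F M"
    and [simp]: "m \<in> carrier M" "s \<in> S" and s: "s \<in> I" "f s = T +>\<^bsub>M\<^esub> m"
  shows "fraction_germ (fraction S M m s) = germ_rel R F M `` {(I, f)}"
proof (intro equalityI subrelI)
  fix J g assume "(J, g) \<in> fraction_germ (fraction S M m s)"
  then obtain n t where Jg: "(J, g) \<in> local_maps R F M" and nt: "(n, t) \<in> fraction S M m s"
    and t: "t \<in> J" "g t = T +>\<^bsub>M\<^esub> n" by (auto simp: fraction_germ_def)
  note [simp] = mem_fraction[OF _ _ nt, simplified]
  from mem_fraction(3)[OF \<open>m \<in> carrier M\<close> \<open>s \<in> S\<close> nt] obtain u where [simp]: "u \<in> S"
    and u: "u \<odot>\<^bsub>M\<^esub> (s \<odot>\<^bsub>M\<^esub> n) = u \<odot>\<^bsub>M\<^esub> (t \<odot>\<^bsub>M\<^esub> m)" by (subst (asm) fraction_eq_iff) auto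
  \<comment> \<open>The factor \<open>u\<close> that identifies the two fractions makes \<open>f\<close> and \<open>g\<close> agree at \<open>u s t\<close>.\<close>
  have "u \<otimes> s \<otimes> t = u \<otimes> t \<otimes> s" by (simp add: R.m_ac)
  moreover have "f (u \<otimes> t \<otimes> s) = T +>\<^bsub>M\<^esub> ((u \<otimes> t) \<odot>\<^bsub>M\<^esub> m)" "u \<otimes> t \<otimes> s \<in> I"
    using local_maps_scale[OF If s(1) _ _ s(2), of "u \<otimes> t"] by auto
  moreover have "g (u \<otimes> s \<otimes> t) = T +>\<^bsub>M\<^esub> ((u \<otimes> s) \<odot>\<^bsub>M\<^esub> n)" "u \<otimes> s \<otimes> t \<in> J"
    using local_maps_scale[OF Jg t(1) _ _ t(2), of "u \<otimes> s"] by auto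
  ultimately have "u \<otimes> s \<otimes> t \<in> S \<inter> I \<inter> J" "f (u \<otimes> s \<otimes> t) = g (u \<otimes> s \<otimes> t)"
    by (simp_all add: u smult_assoc1)
  then show "(J, g) \<in> germ_rel R F M `` {(I, f)}"
    using If Jg by (auto simp: germ_rel_iff)
next
  fix J g assume "(J, g) \<in> germ_rel R F M `` {(I, f)}"
  then obtain v where Jg: "(J, g) \<in> local_maps R F M"
    and v: "v \<in> S" "v \<in> I" "v \<in> J" "f v = g v" by (auto simp: germ_rel_iff)
  from local_mapsD(3)[OF Jg \<open>v \<in> J\<close>] obtain n where n: "n \<in> carrier M" "g v = T +>\<^bsub>M\<^esub> n"
    by (rule Q_cases)
  have "fraction S M m s = fraction S M n v"
    using v n by (intro local_map_value_unique[OF If _ _ _ _ s]) auto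
  then have "(n, v) \<in> fraction S M m s"
    using fraction_self[of n v] v n by simp
  then show "(J, g) \<in> fraction_germ (fraction S M m s)"
    using Jg v n by (auto simp: fraction_germ_def)
qed

text \<open>
  This is the tool for all operations below: the germ of a map is found by
  evaluating the map at one element of \<open>S\<close>.
\<close>
lemma germ_eq_fraction_germ:
  assumes "(I, restrict f I) \<in> local_maps R F M"
    and "m \<in> carrier M" "s \<in> S" "s \<in> I" "f s = T +>\<^bsub>M\<^esub> m"
  shows "germ R F M I f = fraction_germ (fraction S M m s)"
  using fraction_germ_eq[OF assms(1-4)] assms(4,5) by (simp add: germ_def)

lemma fraction_germ_nonempty:
  assumes "X \<in> carrier (fraction_module R S M)"
  shows "fraction_germ X \<noteq> {}"
proof -
  obtain m s where ms: "m \<in> carrier M" "s \<in> S" "X = fraction S M m s"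
    using assms by (rule fraction_cases)
  obtain I f where "(I, f) \<in> local_maps R F M" "s \<in> I" "f s = T +>\<^bsub>M\<^esub> m"
    using local_map_of_fraction[OF ms(1,2)] .
  then show ?thesis
    using ms fraction_self[of m s] by (auto simp: fraction_germ_def)
qed

lemma fraction_germ_elim:
  assumes "X \<in> carrier (fraction_module R S M)" and "(I, f) \<in> fraction_germ X"
  obtains m s where "(I, f) \<in> local_maps R F M" "m \<in> carrier M" "s \<in> S" "X = fraction S M m s"
    "s \<in> I" "f s = T +>\<^bsub>M\<^esub> m"
proof -
  obtain n t where "n \<in> carrier M" "t \<in> S" "X = fraction S M n t"
    using assms(1) by (rule fraction_cases)
  moreover obtain m s where "(I, f) \<in> local_maps R F M" "(m, s) \<in> X" "s \<in> I" "f s = T +>\<^bsub>M\<^esub> m"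
    using assms(2) by (auto simp: fraction_germ_def)
  ultimately show ?thesis using that mem_fraction[of n t m s] by metis
qed

lemma bij_fraction_germ:
  "bij_betw fraction_germ (carrier (fraction_module R S M)) (carrier (localization_module R F M))"
proof (rule bij_betw_imageI)
  show "inj_on fraction_germ (carrier (fraction_module R S M))"
  proof (rule inj_onI)
    fix X Y assume X: "X \<in> carrier (fraction_module R S M)" and Y: "Y \<in> carrier (fraction_module R S M)"
      and eq: "fraction_germ X = fraction_germ Y"
    obtain I f where If: "(I, f) \<in> fraction_germ X"
      using fraction_germ_nonempty[OF X] by auto
    obtain m s where 1: "(I, f) \<in> local_maps R F M" "m \<in> carrier M" "s \<in> S" "X = fraction S M m s"
      "s \<in> I" "f s = T +>\<^bsub>M\<^esub> m" using fraction_germ_elim[OF X If] .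
    obtain n t where 2: "n \<in> carrier M" "t \<in> S" "Y = fraction S M n t"
      "t \<in> I" "f t = T +>\<^bsub>M\<^esub> n" using fraction_germ_elim[OF Y If[unfolded eq]] .
    show "X = Y"
      using local_map_value_unique[OF 1(1,2) 2(1) 1(3) 2(2) 1(5,6) 2(4,5)] 1(4) 2(3) by simp
  qed
  show "fraction_germ ` carrier (fraction_module R S M) = carrier (localization_module R F M)"
  proof (intro equalityI subsetI)
    fix G assume "G \<in> fraction_germ ` carrier (fraction_module R S M)"
    then obtain m s where ms: "m \<in> carrier M" "s \<in> S" "G = fraction_germ (fraction S M m s)"
      by (auto elim!: fraction_cases)
    obtain I f where "(I, f) \<in> local_maps R F M" "s \<in> I" "f s = T +>\<^bsub>M\<^esub> m"
      using local_map_of_fraction[OF ms(1,2)] .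
    then show "G \<in> carrier (localization_module R F M)"
      using ms by (auto simp: fraction_germ_eq localization_module_def intro!: quotientI)
  next
    fix G assume "G \<in> carrier (localization_module R F M)"
    then obtain I f where If: "(I, f) \<in> local_maps R F M" "G = germ_rel R F M `` {(I, f)}"
      by (auto simp: localization_module_def elim!: quotientE)
    obtain m s where "m \<in> carrier M" "s \<in> S" "s \<in> I" "f s = T +>\<^bsub>M\<^esub> m"
      using local_map_fraction_exists[OF If(1)] .
    then show "G \<in> fraction_germ ` carrier (fraction_module R S M)"
      using fraction_germ_eq[OF If(1)] If(2) by (auto intro!: image_eqI[of _ _ "fraction S M m s"])
  qed
qed

lemma F_Int:
  assumes "I \<in> F" "J \<in> F" shows "I \<inter> J \<in> F"
proof -
  from assms obtain s t where st: "s \<in> S" "s \<in> I" "t \<in> S" "t \<in> J" and I: "ideal I R" "ideal J R"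
    by (auto simp: ideals_meeting_def)
  then have "s \<otimes> t \<in> S \<inter> (I \<inter> J)"
    by (auto intro: ideal.I_l_closed ideal.I_r_closed)
  then show ?thesis
    using R.i_intersect[OF I] by (auto simp: ideals_meeting_def)
qed

text \<open>
  If \<open>f s = m + T\<close> and \<open>g t = n + T\<close>, then \<open>f + g\<close> takes at \<open>s t\<close> the value
  \<open>t m + s n + T\<close>, the numerator of the sum of the two fractions.
\<close>
lemma fraction_germ_add:
  assumes X: "X \<in> carrier (fraction_module R S M)" and Y: "Y \<in> carrier (fraction_module R S M)"
  shows "fraction_germ (X \<oplus>\<^bsub>fraction_module R S M\<^esub> Y) =
    fraction_germ X \<oplus>\<^bsub>localization_module R F M\<^esub> fraction_germ Y"
  unfolding localization_module_def ring.simps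
proof (rule UN_pairs_const2[symmetric])
  fix I f J g assume If: "(I, f) \<in> fraction_germ X" and Jg: "(J, g) \<in> fraction_germ Y"
  obtain m s where f: "(I, f) \<in> local_maps R F M" and [simp]: "m \<in> carrier M" "s \<in> S"
    and X_eq: "X = fraction S M m s" and s: "s \<in> I" "f s = T +>\<^bsub>M\<^esub> m"
    using fraction_germ_elim[OF X If] .
  obtain n t where g: "(J, g) \<in> local_maps R F M" and [simp]: "n \<in> carrier M" "t \<in> S"
    and Y_eq: "Y = fraction S M n t" and t: "t \<in> J" "g t = T +>\<^bsub>M\<^esub> n"
    using fraction_germ_elim[OF Y Jg] .
  note f' = local_mapsD[OF f] and g' = local_mapsD[OF g]
  have lm: "(I \<inter> J, \<lambda>a\<in>I \<inter> J. f a \<oplus>\<^bsub>Q\<^esub> g a) \<in> local_maps R F M"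
    by (rule local_mapsI) (auto simp: F_Int f' g' Q.M.a_ac Q.smult_r_distr)
  have "t \<otimes> s \<in> I" "f (t \<otimes> s) = T +>\<^bsub>M\<^esub> (t \<odot>\<^bsub>M\<^esub> m)"
    using local_maps_scale[OF f s(1) _ _ s(2)] by auto
  moreover have "s \<otimes> t \<in> J" "g (s \<otimes> t) = T +>\<^bsub>M\<^esub> (s \<odot>\<^bsub>M\<^esub> n)"
    using local_maps_scale[OF g t(1) _ _ t(2)] by auto
  ultimately show "germ R F M (I \<inter> J) (\<lambda>a. f a \<oplus>\<^bsub>Q\<^esub> g a) = fraction_germ (X \<oplus>\<^bsub>fraction_module R S M\<^esub> Y)"
    by (simp add: X_eq Y_eq fraction_add germ_eq_fraction_germ[OF lm] Q_add R.m_comm[of t s])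
qed (use fraction_germ_nonempty assms in blast)+

lemma fraction_germ_smult:
  assumes [simp]: "r \<in> carrier R" and X: "X \<in> carrier (fraction_module R S M)"
  shows "fraction_germ (r \<odot>\<^bsub>fraction_module R S M\<^esub> X) = r \<odot>\<^bsub>localization_module R F M\<^esub> fraction_germ X"
  unfolding localization_module_def module.simps
proof (rule UN_pairs_const[symmetric])
  fix I f assume If: "(I, f) \<in> fraction_germ X"
  obtain m s where f: "(I, f) \<in> local_maps R F M" and [simp]: "m \<in> carrier M" "s \<in> S"
    and X_eq: "X = fraction S M m s" and s: "s \<in> I" "f s = T +>\<^bsub>M\<^esub> m"
    using fraction_germ_elim[OF X If] .
  note f' = local_mapsD[OF f]
  have lm: "(I, \<lambda>a\<in>I. r \<odot>\<^bsub>Q\<^esub> f a) \<in> local_maps R F M"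
  proof (rule local_mapsI)
    fix q a assume "q \<in> carrier R" "a \<in> I"
    then show "r \<odot>\<^bsub>Q\<^esub> f (q \<otimes> a) = q \<odot>\<^bsub>Q\<^esub> (r \<odot>\<^bsub>Q\<^esub> f a)"
      by (simp add: f' R.m_comm flip: Q.smult_assoc1)
  qed (auto simp: f' Q.smult_r_distr)
  show "germ R F M I (\<lambda>a. r \<odot>\<^bsub>Q\<^esub> f a) = fraction_germ (r \<odot>\<^bsub>fraction_module R S M\<^esub> X)"
    by (simp add: X_eq fraction_smult germ_eq_fraction_germ[OF lm] s Q_smult)
qed (use fraction_germ_nonempty assms in blast)

lemma fraction_germ_map:
  assumes [simp]: "m \<in> carrier M"
  shows "fraction_germ (fraction_map R S M m) = localization_map R F M m"
proof -
  have "(carrier R, \<lambda>r\<in>carrier R. T +>\<^bsub>M\<^esub> (r \<odot>\<^bsub>M\<^esub> m)) \<in> local_maps R F M"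
    by (rule local_mapsI)
      (auto simp: carrier_in_F Q_add Q_smult smult_l_distr smult_assoc1)
  then show ?thesis
    unfolding localization_map_def fraction_map_def
    by (intro germ_eq_fraction_germ[symmetric]) auto
qed

lemma fraction_germ_zero:
  "fraction_germ \<zero>\<^bsub>fraction_module R S M\<^esub> = \<zero>\<^bsub>localization_module R F M\<^esub>"
proof -
  have "(carrier R, \<lambda>r\<in>carrier R. \<zero>\<^bsub>Q\<^esub>) \<in> local_maps R F M"
    by (rule local_mapsI) (auto simp: carrier_in_F)
  then show ?thesis
    unfolding localization_module_def fraction_zero ring.simps
    by (intro germ_eq_fraction_germ[symmetric]) (auto simp: Q_zero)
qed

lemma module_localization_module: "module R (localization_module R F M)"
  by (rule module_transport[OF module_fraction_module bij_fraction_germ])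
    (auto simp: fraction_germ_add fraction_germ_smult fraction_germ_zero)

lemma linear_fraction_germ:
  "linear_map R (fraction_module R S M) (localization_module R F M) fraction_germ"
  using module_fraction_module module_localization_module bij_betwE[OF bij_fraction_germ]
  by (auto simp: linear_map_def linear_maps_def fraction_germ_add fraction_germ_smult)

lemma smult_localization_cancel:
  assumes "s \<in> S" "G \<in> carrier (localization_module R F M)" "H \<in> carrier (localization_module R F M)"
    and "s \<odot>\<^bsub>localization_module R F M\<^esub> G = s \<odot>\<^bsub>localization_module R F M\<^esub> H"
  shows "G = H"
proof -
  interpret fr: module R "fraction_module R S M" by (rule module_fraction_module)
  obtain X Y where XY: "X \<in> carrier (fraction_module R S M)" "Y \<in> carrier (fraction_module R S M)"
    "G = fraction_germ X" "H = fraction_germ Y"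
    using assms(2,3) unfolding bij_betw_imp_surj_on[OF bij_fraction_germ, symmetric] by (elim imageE)
  have "s \<odot>\<^bsub>fraction_module R S M\<^esub> X = s \<odot>\<^bsub>fraction_module R S M\<^esub> Y"
  proof (rule inj_onD[OF bij_betw_imp_inj_on[OF bij_fraction_germ]])
    show "fraction_germ (s \<odot>\<^bsub>fraction_module R S M\<^esub> X) = fraction_germ (s \<odot>\<^bsub>fraction_module R S M\<^esub> Y)"
      using assms(1,4) XY by (simp add: fraction_germ_smult)
  qed (use assms(1) XY in auto)
  then show ?thesis
    using smult_fraction_module_cancel[OF assms(1) XY(1,2)] XY by simp
qed

text \<open>
  For every competitor \<open>\<phi>\<close> the element \<open>s\<close> times \<open>\<phi> (m/s)\<close> is the canonical image of
  \<open>m\<close>, and \<open>s\<close> can be cancelled among germs.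
\<close>
lemma linear_map_eq_fraction_germ:
  assumes lin: "linear_map R (fraction_module R S M) (localization_module R F M) \<phi>"
    and comm: "\<forall>m\<in>carrier M. localization_map R F M m = \<phi> (fraction_map R S M m)"
    and X: "X \<in> carrier (fraction_module R S M)"
  shows "\<phi> X = fraction_germ X"
proof -
  obtain m s where [simp]: "m \<in> carrier M" "s \<in> S" and X_eq: "X = fraction S M m s"
    using X by (rule fraction_cases)
  have scale: "s \<odot>\<^bsub>localization_module R F M\<^esub> \<psi> X = localization_map R F M m"
    if "linear_map R (fraction_module R S M) (localization_module R F M) \<psi>"
      "localization_map R F M m = \<psi> (fraction_map R S M m)" for \<psi>
  proof -
    have "s \<odot>\<^bsub>localization_module R F M\<^esub> \<psi> X = \<psi> (s \<odot>\<^bsub>fraction_module R S M\<^esub> X)"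
      using that(1) X by (simp add: linear_map_def linear_maps_def)
    also have "\<dots> = \<psi> (fraction_map R S M m)"
      by (simp add: X_eq smult_fraction_eq_map)
    finally show ?thesis using that(2) by simp
  qed
  have closed: "\<psi> X \<in> carrier (localization_module R F M)"
    if "linear_map R (fraction_module R S M) (localization_module R F M) \<psi>" for \<psi>
    using that X by (auto simp: linear_map_def linear_maps_def)
  show ?thesis
  proof (rule smult_localization_cancel[of s])
    show "s \<odot>\<^bsub>localization_module R F M\<^esub> \<phi> X = s \<odot>\<^bsub>localization_module R F M\<^esub> fraction_germ X"
      using scale[OF lin] scale[OF linear_fraction_germ] comm by (simp add: fraction_germ_map)
  qed (auto intro: closed lin linear_fraction_germ)
qed

end


section \<open>The ring structure\<close>

lemma regular_module_simps [simp]: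
  "carrier (regular_module R) = carrier R"
  "zero (regular_module R) = zero R" "one (regular_module R) = one R"
  "add (regular_module R) = add R" "mult (regular_module R) = mult R"
  "smult (regular_module R) = mult R"
  by (simp_all add: regular_module_def)

lemma regular_module_coset [simp]: "A +>\<^bsub>regular_module R\<^esub> x = A +>\<^bsub>R\<^esub> x"
  by (simp add: a_r_coset_def r_coset_def)

lemma module_regular_module:
  assumes "cring R" shows "module R (regular_module R)"
proof -
  interpret cring R by fact
  show ?thesis
  proof (rule moduleI)
    show "abelian_group (regular_module R)"
    proof (rule abelian_groupI)
      fix x assume "x \<in> carrier (regular_module R)"
      then show "\<exists>y\<in>carrier (regular_module R). y \<oplus>\<^bsub>regular_module R\<^esub> x = \<zero>\<^bsub>regular_module R\<^esub>"
        by (intro bexI[of _ "\<ominus>\<^bsub>R\<^esub> x"]) (auto simp: l_neg)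
    qed (auto simp: a_ac)
  qed (auto simp: is_cring l_distr r_distr m_assoc)
qed

locale ring_of_fractions = cring R for R (structure) +
  fixes S
  assumes denominators: "submonoid S R"

sublocale ring_of_fractions \<subseteq> N: fractions R "regular_module R" S
  by (intro fractions.intro module_regular_module fractions_axioms.intro denominators is_cring)

context ring_of_fractions
begin

abbreviation F where "F \<equiv> ideals_meeting R S"
abbreviation T where "T \<equiv> torsion R F (regular_module R)"
abbreviation Fr where "Fr \<equiv> fraction S (regular_module R)"

lemma fraction_algebra_simps [simp]:
  "carrier (fraction_algebra R S) = carrier (fraction_module R S (regular_module R))"
  "add (fraction_algebra R S) = add (fraction_module R S (regular_module R))"
  "zero (fraction_algebra R S) = zero (fraction_module R S (regular_module R))"
  "smult (fraction_algebra R S) = smult (fraction_module R S (regular_module R))"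
  "one (fraction_algebra R S) = Fr \<one> \<one>"
  by (simp_all add: fraction_algebra_def)

lemma localization_algebra_simps [simp]:
  "carrier (localization_algebra R F) = carrier (localization_module R F (regular_module R))"
  "add (localization_algebra R F) = add (localization_module R F (regular_module R))"
  "zero (localization_algebra R F) = zero (localization_module R F (regular_module R))"
  "smult (localization_algebra R F) = smult (localization_module R F (regular_module R))"
  by (simp_all add: localization_algebra_def)

lemma fraction_mult:
  assumes [simp]: "a \<in> carrier R" "b \<in> carrier R" "s \<in> S" "t \<in> S"
  shows "Fr a s \<otimes>\<^bsub>fraction_algebra R S\<^esub> Fr b t = Fr (a \<otimes> b) (s \<otimes> t)"
proof -
  have "(\<Union>(a, s)\<in>Fr a s. \<Union>(b, t)\<in>Fr b t. Fr (a \<otimes> b) (s \<otimes> t)) = Fr (a \<otimes> b) (s \<otimes> t)"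
  proof (rule UN_pairs_const2)
    fix a' s' b' t' assume X: "(a', s') \<in> Fr a s" and Y: "(b', t') \<in> Fr b t"
    from N.mem_fraction[OF _ _ X] N.mem_fraction[OF _ _ Y]
    have [simp]: "a' \<in> carrier R" "b' \<in> carrier R" "s' \<in> S" "t' \<in> S" and
      eqs: "Fr a' s' = Fr a s" "Fr b' t' = Fr b t" by auto
    from eqs(1) obtain u where [simp]: "u \<in> S" and u: "u \<otimes> (s \<otimes> a') = u \<otimes> (s' \<otimes> a)"
      by (subst (asm) N.fraction_eq_iff) auto
    from eqs(2) obtain v where [simp]: "v \<in> S" and v: "v \<otimes> (t \<otimes> b') = v \<otimes> (t' \<otimes> b)"
      by (subst (asm) N.fraction_eq_iff) auto
    have "(u \<otimes> v) \<otimes> ((s \<otimes> t) \<otimes> (a' \<otimes> b')) = (u \<otimes> (s \<otimes> a')) \<otimes> (v \<otimes> (t \<otimes> b'))"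
      by (simp add: m_ac)
    also have "\<dots> = (u \<otimes> v) \<otimes> ((s' \<otimes> t') \<otimes> (a \<otimes> b))"
      unfolding u v by (simp add: m_ac)
    finally show "Fr (a' \<otimes> b') (s' \<otimes> t') = Fr (a \<otimes> b) (s \<otimes> t)"
      by (subst N.fraction_eq_iff) (auto intro!: bexI[of _ "u \<otimes> v"])
  qed (use N.fraction_self[of a s] N.fraction_self[of b t] assms in auto)
  then show ?thesis by (simp add: fraction_algebra_def)
qed

lemma fraction_ring_cases:
  assumes "X \<in> carrier (fraction_module R S (regular_module R))"
  obtains a s where "a \<in> carrier R" "s \<in> S" "X = Fr a s"
  using N.fraction_cases[OF assms] by auto

lemma cring_fraction_algebra: "cring (fraction_algebra R S)"
proof (rule cringI)
  interpret A: module R "fraction_module R S (regular_module R)"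
    by (rule N.module_fraction_module)
  show "abelian_group (fraction_algebra R S)"
    by (rule abelian_groupI) (auto simp: A.M.a_ac intro: A.M.l_neg)
  show "comm_monoid (fraction_algebra R S)"
    by (rule comm_monoidI) (auto elim!: fraction_ring_cases simp: fraction_mult m_ac)
next
  fix X Y Z assume "X \<in> carrier (fraction_algebra R S)" "Y \<in> carrier (fraction_algebra R S)"
    "Z \<in> carrier (fraction_algebra R S)"
  then obtain a s b t c v where [simp]: "a \<in> carrier R" "s \<in> S" "b \<in> carrier R" "t \<in> S"
    "c \<in> carrier R" "v \<in> S" and XYZ: "X = Fr a s" "Y = Fr b t" "Z = Fr c v"
    by (auto elim!: fraction_ring_cases)
  \<comment> \<open>The right-hand side acquires the denominator of \<open>Z\<close> twice; one copy cancels.\<close>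
  have "Fr ((v \<otimes> ((t \<otimes> a \<oplus> s \<otimes> b) \<otimes> c))) (v \<otimes> (s \<otimes> t \<otimes> v)) = Fr ((t \<otimes> a \<oplus> s \<otimes> b) \<otimes> c) (s \<otimes> t \<otimes> v)"
    using N.fraction_cancel[of "(t \<otimes> a \<oplus> s \<otimes> b) \<otimes> c" "s \<otimes> t \<otimes> v" v] by simp
  then show "(X \<oplus>\<^bsub>fraction_algebra R S\<^esub> Y) \<otimes>\<^bsub>fraction_algebra R S\<^esub> Z =
      X \<otimes>\<^bsub>fraction_algebra R S\<^esub> Z \<oplus>\<^bsub>fraction_algebra R S\<^esub> Y \<otimes>\<^bsub>fraction_algebra R S\<^esub> Z"
    using N.fraction_add[of "a \<otimes> c" "b \<otimes> c" "s \<otimes> v" "t \<otimes> v"] N.fraction_add[of a b s t]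
    by (simp add: XYZ fraction_mult l_distr r_distr m_ac)
qed

lemma algebra_fraction_algebra: "algebra R (fraction_algebra R S)"
proof -
  interpret A: module R "fraction_module R S (regular_module R)"
    by (rule N.module_fraction_module)
  show ?thesis
  proof (rule algebraI)
    fix r X Y assume "r \<in> carrier R" "X \<in> carrier (fraction_algebra R S)"
      "Y \<in> carrier (fraction_algebra R S)"
    then obtain a s b t where "r \<in> carrier R" "a \<in> carrier R" "s \<in> S" "b \<in> carrier R" "t \<in> S"
      "X = Fr a s" "Y = Fr b t"
      by (auto elim!: fraction_ring_cases)
    then show "(r \<odot>\<^bsub>fraction_algebra R S\<^esub> X) \<otimes>\<^bsub>fraction_algebra R S\<^esub> Y =
        r \<odot>\<^bsub>fraction_algebra R S\<^esub> (X \<otimes>\<^bsub>fraction_algebra R S\<^esub> Y)"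
      using N.fraction_smult[of r a s] N.fraction_smult[of r "a \<otimes> b" "s \<otimes> t"]
      by (simp add: fraction_mult m_assoc)
  qed (auto simp: is_cring cring_fraction_algebra A.smult_l_distr A.smult_r_distr A.smult_assoc1)
qed

interpretation Q: module R "torsion_quotient R F (regular_module R)"
  by (rule N.module_Q)

text \<open>
  The map induced by \<open>g\<close> is well defined: if \<open>b\<close> and \<open>c\<close> have the same coset, some \<open>s \<in> S\<close>
  has \<open>s b = s c\<close>, so \<open>s\<close> identifies the values \<open>g b\<close> and \<open>g c\<close> in a torsion-free module.
\<close>
lemma induced_map_coset:
  assumes g: "(J, g) \<in> local_maps R F (regular_module R)" and b: "b \<in> J"
  shows "induced_map R F J g (T +>\<^bsub>R\<^esub> b) = g b"
  unfolding induced_map_def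
proof (rule the_equality)
  note g' = N.local_mapsD[OF g]
  interpret J: ideal J R by (rule g'(2))
  fix y assume "\<exists>c\<in>J. T +>\<^bsub>R\<^esub> b = T +>\<^bsub>R\<^esub> c \<and> y = g c"
  then obtain c where c: "c \<in> J" "T +>\<^bsub>R\<^esub> b = T +>\<^bsub>R\<^esub> c" "y = g c" by auto
  then obtain s where s: "s \<in> S" "s \<otimes> b = s \<otimes> c"
    using N.coset_eq_iff[of b c] b J.Icarr by auto
  have "g (s \<otimes> b) = g (s \<otimes> c)" using s by simp
  then have "g b = g c"
    by (intro N.Q_torsion_free[OF s(1) g'(3)[OF b] g'(3)[OF c(1)]]) (simp add: g'(5) s(1) b c(1))
  then show "y = g b" using c by simp
qed (use b in auto)

text \<open>
  The set on which the composite is defined is an ideal meeting \<open>S\<close>: if \<open>s \<in> I\<close> and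
  \<open>t \<in> J\<close> lie in \<open>S\<close> and \<open>f s = m + T\<close>, then \<open>f (t s) = t m + T\<close> with \<open>t m \<in> J\<close>.
\<close>
lemma local_maps_mult:
  assumes f: "(I, f) \<in> local_maps R F (regular_module R)"
    and g: "(J, g) \<in> local_maps R F (regular_module R)"
  defines "D \<equiv> {a \<in> I. f a \<in> image_ideal R F J}"
  shows "(D, \<lambda>a\<in>D. induced_map R F J g (f a)) \<in> local_maps R F (regular_module R)"
proof -
  note f' = N.local_mapsD[OF f] and g' = N.local_mapsD[OF g]
  interpret I: ideal I R by (rule f'(2))
  interpret J: ideal J R by (rule g'(2))
  have D_iff: "a \<in> D \<longleftrightarrow> a \<in> I \<and> (\<exists>b\<in>J. f a = T +>\<^bsub>R\<^esub> b)" for a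
    by (auto simp: D_def image_ideal_def)
  have add: "f (a \<oplus> a') = T +>\<^bsub>R\<^esub> (b \<oplus> b')"
    if "a \<in> I" "a' \<in> I" "b \<in> J" "b' \<in> J" "f a = T +>\<^bsub>R\<^esub> b" "f a' = T +>\<^bsub>R\<^esub> b'" for a a' b b'
    using that N.Q_add[of b b'] J.Icarr by (simp add: f'(4))
  have smult: "f (r \<otimes> a) = T +>\<^bsub>R\<^esub> (r \<otimes> b)"
    if "r \<in> carrier R" "a \<in> I" "b \<in> J" "f a = T +>\<^bsub>R\<^esub> b" for r a b
    using that N.Q_smult[of r b] J.Icarr by (simp add: f'(5))
  have D_add: "a \<oplus> a' \<in> D" if "a \<in> D" "a' \<in> D" for a a'
  proof -
    from that obtain b b' where "a \<in> I" "a' \<in> I" "b \<in> J" "b' \<in> J" "f a = T +>\<^bsub>R\<^esub> b" "f a' = T +>\<^bsub>R\<^esub> b'"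
      unfolding D_iff by blast
    with add[OF this] show ?thesis
      unfolding D_iff by (blast intro: I.a_closed J.a_closed)
  qed
  have D_smult: "r \<otimes> a \<in> D" if "r \<in> carrier R" "a \<in> D" for r a
  proof -
    from that obtain b where "a \<in> I" "b \<in> J" "f a = T +>\<^bsub>R\<^esub> b"
      unfolding D_iff by blast
    with smult[OF that(1) this] show ?thesis
      unfolding D_iff by (blast intro: I.I_l_closed J.I_l_closed that(1))
  qed
  obtain m s where s: "m \<in> carrier R" "s \<in> S" "s \<in> I" "f s = T +>\<^bsub>R\<^esub> m"
    using N.local_map_fraction_exists[OF f, unfolded regular_module_simps regular_module_coset] .
  obtain t where t: "t \<in> S" "t \<in> J" using g'(1) by (auto simp: ideals_meeting_def)
  have "f (t \<otimes> s) = T +>\<^bsub>R\<^esub> (t \<otimes> m)"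
    using N.local_maps_scale(2)[OF f s(3), of t m] s t by simp
  then have ts: "t \<otimes> s \<in> D"
    using s t by (auto simp: D_iff I.I_l_closed J.I_r_closed)
  have "ideal D R"
  proof (rule idealI)
    show "ring R" by (rule ring_axioms)
    have D_carrier: "D \<subseteq> carrier R" using I.Icarr by (auto simp: D_def)
    show "subgroup D (add_monoid R)"
    proof (rule add.subgroupI)
      fix a assume "a \<in> D"
      then show "\<ominus> a \<in> D"
        using D_smult[of "\<ominus> \<one>" a] D_carrier by (auto simp: l_minus)
    qed (use ts D_add D_carrier in auto)
    fix a x assume "a \<in> D" "x \<in> carrier R"
    then show "x \<otimes> a \<in> D" "a \<otimes> x \<in> D"
      using D_smult[of x a] D_carrier by (auto simp: m_comm[of a x])
  qed
  then have "D \<in> F" using ts s t by (auto simp: ideals_meeting_def)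
  then show ?thesis
  proof (rule N.local_mapsI)
    fix a assume "a \<in> D"
    then show "induced_map R F J g (f a) \<in> carrier (torsion_quotient R F (regular_module R))"
      by (auto simp: D_iff induced_map_coset[OF g] g')
  next
    fix a a' assume "a \<in> D" "a' \<in> D"
    then show "induced_map R F J g (f (a \<oplus> a')) = induced_map R F J g (f a)
        \<oplus>\<^bsub>torsion_quotient R F (regular_module R)\<^esub> induced_map R F J g (f a')"
      by (auto simp: D_iff add induced_map_coset[OF g] g')
  next
    fix r a assume "r \<in> carrier R" "a \<in> D"
    then show "induced_map R F J g (f (r \<otimes> a)) =
        r \<odot>\<^bsub>torsion_quotient R F (regular_module R)\<^esub> induced_map R F J g (f a)"
      by (auto simp: D_iff smult induced_map_coset[OF g] g' J.I_l_closed)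
  qed
qed

text \<open>
  The composite is evaluated at \<open>s t\<close>: if \<open>f s = a + T\<close> and \<open>g t = b + T\<close>, then
  \<open>f (s t) = a t + T\<close>, and \<open>g\<close> sends \<open>a t\<close> to \<open>a b + T\<close>.
\<close>
lemma fraction_germ_mult:
  assumes X: "X \<in> carrier (fraction_algebra R S)" and Y: "Y \<in> carrier (fraction_algebra R S)"
  shows "N.fraction_germ (X \<otimes>\<^bsub>fraction_algebra R S\<^esub> Y) =
    N.fraction_germ X \<otimes>\<^bsub>localization_algebra R F\<^esub> N.fraction_germ Y"
proof -
  have "(\<Union>(I, f)\<in>N.fraction_germ X. \<Union>(J, g)\<in>N.fraction_germ Y.
      germ R F (regular_module R) {a \<in> I. f a \<in> image_ideal R F J} (\<lambda>a. induced_map R F J g (f a))) =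
    N.fraction_germ (X \<otimes>\<^bsub>fraction_algebra R S\<^esub> Y)"
  proof (rule UN_pairs_const2)
    fix I f J g assume If: "(I, f) \<in> N.fraction_germ X" and Jg: "(J, g) \<in> N.fraction_germ Y"
    obtain a s where f: "(I, f) \<in> local_maps R F (regular_module R)"
      and [simp]: "a \<in> carrier R" "s \<in> S" and X_eq: "X = Fr a s" and s: "s \<in> I" "f s = T +>\<^bsub>R\<^esub> a"
      using N.fraction_germ_elim[OF X[unfolded fraction_algebra_simps] If,
          unfolded regular_module_simps regular_module_coset] .
    obtain b t where g: "(J, g) \<in> local_maps R F (regular_module R)"
      and [simp]: "b \<in> carrier R" "t \<in> S" and Y_eq: "Y = Fr b t" and t: "t \<in> J" "g t = T +>\<^bsub>R\<^esub> b"
      using N.fraction_germ_elim[OF Y[unfolded fraction_algebra_simps] Jg,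
          unfolded regular_module_simps regular_module_coset] .
    have "t \<otimes> s \<in> I" "f (t \<otimes> s) = T +>\<^bsub>R\<^esub> (t \<otimes> a)"
      using N.local_maps_scale[OF f s(1), of t a] s(2) by auto
    then have f_st: "s \<otimes> t \<in> I" "f (s \<otimes> t) = T +>\<^bsub>R\<^esub> (a \<otimes> t)"
      by (simp_all add: m_comm)
    have g_at: "a \<otimes> t \<in> J" "g (a \<otimes> t) = T +>\<^bsub>R\<^esub> (a \<otimes> b)"
      using N.local_maps_scale[OF g t(1), of a b] t(2) by auto
    have "induced_map R F J g (f (s \<otimes> t)) = T +>\<^bsub>R\<^esub> (a \<otimes> b)"
      using f_st g_at by (simp add: induced_map_coset[OF g])
    then have "germ R F (regular_module R) {a \<in> I. f a \<in> image_ideal R F J}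
        (\<lambda>a. induced_map R F J g (f a)) = N.fraction_germ (Fr (a \<otimes> b) (s \<otimes> t))"
      using f_st g_at
      by (intro N.germ_eq_fraction_germ[OF local_maps_mult[OF f g]]) (auto simp: image_ideal_def)
    then show "germ R F (regular_module R) {a \<in> I. f a \<in> image_ideal R F J}
        (\<lambda>a. induced_map R F J g (f a)) = N.fraction_germ (X \<otimes>\<^bsub>fraction_algebra R S\<^esub> Y)"
      by (simp add: X_eq Y_eq fraction_mult)
  qed (use N.fraction_germ_nonempty assms in auto)
  then show ?thesis by (simp add: localization_algebra_def)
qed

lemma fraction_germ_one:
  "N.fraction_germ \<one>\<^bsub>fraction_algebra R S\<^esub> = \<one>\<^bsub>localization_algebra R F\<^esub>"
proof -
  have "localization_map R F (regular_module R) \<one> = \<one>\<^bsub>localization_algebra R F\<^esub>"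
    by (auto simp: localization_map_def localization_algebra_def germ_def cong: restrict_cong)
  then show ?thesis
    using N.fraction_germ_map[of \<one>] by (simp add: fraction_map_def)
qed

lemma algebra_iso_fraction_germ:
  "algebra_iso R (fraction_algebra R S) (localization_algebra R F) N.fraction_germ"
proof -
  interpret A: algebra R "fraction_algebra R S" by (rule algebra_fraction_algebra)
  interpret L: module R "localization_module R F (regular_module R)"
    by (rule N.module_localization_module)
  have iso: "N.fraction_germ \<in> ring_iso (fraction_algebra R S) (localization_algebra R F)"
    using N.bij_fraction_germ bij_betwE[OF N.bij_fraction_germ]
    by (intro ring_iso_memI)
      (auto simp: fraction_germ_mult fraction_germ_one N.fraction_germ_add
        simp del: fraction_algebra_simps(5))
  have cring: "cring (localization_algebra R F)"
    by (rule cring_transport[OF cring_fraction_algebra iso]) (simp add: N.fraction_germ_zero)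
  have surj: "\<exists>X\<in>carrier (fraction_algebra R S). G = N.fraction_germ X"
    if "G \<in> carrier (localization_algebra R F)" for G
    using that bij_betw_imp_surj_on[OF N.bij_fraction_germ] by auto
  have "algebra R (localization_algebra R F)"
  proof (rule algebraI)
    fix r G H assume r: "r \<in> carrier R" and "G \<in> carrier (localization_algebra R F)"
      "H \<in> carrier (localization_algebra R F)"
    then obtain X Y where XY: "X \<in> carrier (fraction_algebra R S)" "Y \<in> carrier (fraction_algebra R S)"
      and GH: "G = N.fraction_germ X" "H = N.fraction_germ Y" using surj by metis
    have smult: "N.fraction_germ (r \<odot>\<^bsub>fraction_algebra R S\<^esub> Z) = r \<odot>\<^bsub>localization_algebra R F\<^esub> N.fraction_germ Z"
      if "Z \<in> carrier (fraction_algebra R S)" for Z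
      using that r by (simp add: N.fraction_germ_smult)
    show "(r \<odot>\<^bsub>localization_algebra R F\<^esub> G) \<otimes>\<^bsub>localization_algebra R F\<^esub> H =
        r \<odot>\<^bsub>localization_algebra R F\<^esub> (G \<otimes>\<^bsub>localization_algebra R F\<^esub> H)"
      unfolding GH
      using XY r A.smult_closed[of r X] A.m_closed[of X Y] A.smult_assoc2[of r X Y]
      by (metis smult fraction_germ_mult)
  qed (auto simp: is_cring cring L.smult_l_distr L.smult_r_distr L.smult_assoc1)
  then show ?thesis
    using algebra_fraction_algebra iso N.linear_fraction_germ
    by (auto simp: algebra_iso_def linear_map_def linear_maps_def)
qed

end

theorem proposition4p11:
  fixes R :: "('a, 'r) ring_scheme" and S :: "'a set" and F :: "'a set set"
    and M :: "('a, 'b, 'm) module_scheme"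
  assumes "cring R" and "submonoid S R" and "F = ideals_meeting R S" and "module R M"
  shows
    "(\<exists>!\<phi>. \<phi> \<in> extensional (carrier (fraction_module R S M)) \<and>
        linear_map R (fraction_module R S M) (localization_module R F M) \<phi> \<and>
        (\<forall>m\<in>carrier M. localization_map R F M m = \<phi> (fraction_map R S M m))) \<and>
     (\<forall>\<phi>. linear_map R (fraction_module R S M) (localization_module R F M) \<phi> \<and>
        (\<forall>m\<in>carrier M. localization_map R F M m = \<phi> (fraction_map R S M m)) \<longrightarrow>
        bij_betw \<phi> (carrier (fraction_module R S M)) (carrier (localization_module R F M))) \<and>
     (\<exists>\<phi>. linear_map R (fraction_module R S (regular_module R))
          (localization_module R F (regular_module R)) \<phi> \<and>
        (\<forall>r\<in>carrier R. localization_map R F (regular_module R) r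
          = \<phi> (fraction_map R S (regular_module R) r)) \<and>
        algebra_iso R (fraction_algebra R S) (localization_algebra R F) \<phi>)"
proof -
  interpret M: fractions R M S
    using assms by (simp add: fractions_def fractions_axioms_def)
  interpret A: ring_of_fractions R S
    using assms by (simp add: ring_of_fractions_def ring_of_fractions_axioms_def)
  let ?Fr = "fraction_module R S M" and ?L = "localization_module R F M"
  have F: "ideals_meeting R S = F" using assms by simp
  let ?P = "\<lambda>\<phi>. linear_map R ?Fr ?L \<phi> \<and>
    (\<forall>m\<in>carrier M. localization_map R F M m = \<phi> (fraction_map R S M m))"
  have unique: "\<phi> X = M.fraction_germ X" if "?P \<phi>" "X \<in> carrier ?Fr" for \<phi> X
    using that M.linear_map_eq_fraction_germ[of \<phi> X] by (simp add: F)
  have bij: "bij_betw \<phi> (carrier ?Fr) (carrier ?L)" if "?P \<phi>" for \<phi>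
    using M.bij_fraction_germ bij_betw_cong[of "carrier ?Fr" \<phi> M.fraction_germ "carrier ?L", OF unique[OF that]]
    by (simp add: F)
  have "?P (restrict M.fraction_germ (carrier ?Fr))"
  proof
    interpret Fr: module R ?Fr by (rule M.module_fraction_module)
    show "linear_map R ?Fr ?L (restrict M.fraction_germ (carrier ?Fr))"
      using M.linear_fraction_germ by (auto simp: linear_map_def linear_maps_def F)
    show "\<forall>m\<in>carrier M. localization_map R F M m =
        restrict M.fraction_germ (carrier ?Fr) (fraction_map R S M m)"
      using M.fraction_germ_map by (simp add: F fraction_map_def)
  qed
  then have ex1: "\<exists>!\<phi>. \<phi> \<in> extensional (carrier ?Fr) \<and> ?P \<phi>"
  proof (intro ex1I conjI)
    fix \<phi> assume "\<phi> \<in> extensional (carrier ?Fr) \<and> ?P \<phi>"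
    then show "\<phi> = restrict M.fraction_germ (carrier ?Fr)"
      using unique[of \<phi>] by (intro extensionalityI[of _ "carrier ?Fr"]) auto
  qed auto
  have "linear_map R (fraction_module R S (regular_module R))
      (localization_module R F (regular_module R)) A.N.fraction_germ \<and>
    (\<forall>r\<in>carrier R. localization_map R F (regular_module R) r
      = A.N.fraction_germ (fraction_map R S (regular_module R) r)) \<and>
    algebra_iso R (fraction_algebra R S) (localization_algebra R F) A.N.fraction_germ"
    using A.N.linear_fraction_germ A.N.fraction_germ_map A.algebra_iso_fraction_germ
    by (simp add: F)
  with ex1 bij show ?thesis by blast
qed

end
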